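(* Let $C$ be a nonempty closed and convex subset of $L_p(S;X)$. Then, for any $g\in C$: (a) $\theta\in \mathcal{S}_C^{-*}(g)$; (b) if $\mathcal{S}_C^{-*}(g)\supsetneq\{\theta\}$, then $\mathcal{S}_C^{-*}(g)$ is a closed cone with vertex at $\theta$ in $L_p(S;X)$. Moreover, (c) in general $\mathcal{S}_C^{-*}(g)$ is not convex; that is, there exist a Bochner space $L_p(S;X)$ of the kind considered, a nonempty closed and convex subset $C\subseteq L_p(S;X)$ and a point $g\in C$ such that $\mathcal{S}_C^{-*}(g)$ is not convex.
   Context: Setting: $(S,\mathcal{A},\mu)$ is a positive complete measure space, $(X,\|\cdot\|_X)$ is a real uniformly convex and uniformly smooth Banach space with dual $X^*$, and $1<p,q<\infty$ with $\frac1p+\frac1q=1$. $L_p(S;X)$ is the Bochner space of ($\mu$-equivalence classes of) strongly $\mu$-measurable $f:S\to X$ with $\|f\|_{L_p(S;X)}=\left(\int_S\|f(s)\|_X^p\,d\mu(s)\right)^{1/p}<\infty$; it is uniformly convex and uniformly smooth with dual $L_q(S;X^* )$ under the pairing $\langle\varphi,f\rangle=\int_S\langle\varphi(s),f(s)\rangle\,d\mu(s)$. The origin of $L_p(S;X)$ is $\theta$. Normalized duality mapping: $J_p:L_p(S;X)\to L_q(S;X^* )$ is the single-valued mapping determined by $\langle J_pf,f\rangle=\|J_pf\|_{L_q(S;X^* )}\|f\|_{L_p(S;X)}=\|f\|_{L_p(S;X)}^2=\|J_pf\|_{L_q(S;X^* )}^2$. For $g\in C$, $$\mathcal{S}_C^{-*}(g)=\left\{h\in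 L_p(S;X):\ \int_S\langle (J_ph)(s),g(s)\rangle\,d\mu(s)=\sup_{f\in C}\int_S\langle (J_ph)(s),f(s)\rangle\,d\mu(s)\right\}.$$ A cone with vertex at $v$ is a nonempty set $K$ such that $v+t(g-v)\in K$ for all $g\in K$ and $t\ge 0$. *)

theory Defs
  imports "HOL-Analysis.Analysis"
begin

text \<open>Both notions below are the usual ones in terms of moduli: the modulus of convexity is
  positive at every \<open>\<epsilon> > 0\<close>, and the modulus of smoothness
  \<open>\<rho>(t) = sup {(\<parallel>x + t y\<parallel> + \<parallel>x - t y\<parallel>) / 2 - 1 | \<parallel>x\<parallel> = \<parallel>y\<parallel> = 1}\<close> satisfies \<open>\<rho>(t) / t \<rightarrow> 0\<close>
  as \<open>t \<rightarrow> 0+\<close>.\<close>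

definition uniformly_convex :: "'x::real_normed_vector itself \<Rightarrow> bool" where
  "uniformly_convex (_ :: 'x itself) \<longleftrightarrow>
     (\<forall>\<epsilon>>0. \<exists>\<delta>>0. \<forall>x y :: 'x. norm x = 1 \<longrightarrow> norm y = 1 \<longrightarrow> norm (x - y) \<ge> \<epsilon>
        \<longrightarrow> norm ((x + y) /\<^sub>R 2) \<le> 1 - \<delta>)"

definition uniformly_smooth :: "'x::real_normed_vector itself \<Rightarrow> bool" where
  "uniformly_smooth (_ :: 'x itself) \<longleftrightarrow>
     (\<forall>\<epsilon>>0. \<exists>\<delta>>0. \<forall>t. 0 < t \<longrightarrow> t < \<delta> \<longrightarrow> (\<forall>x y :: 'x. norm x = 1 \<longrightarrow> norm y = 1
        \<longrightarrow> (norm (x + t *\<^sub>R y) + norm (x - t *\<^sub>R y)) / 2 - 1 \<le> \<epsilon> * t))"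

definition bochner_setting :: "'s measure \<Rightarrow> 'x::banach itself \<Rightarrow> real \<Rightarrow> real \<Rightarrow> bool" where
  "bochner_setting M X p q \<longleftrightarrow> complete_measure M \<and> uniformly_convex X \<and> uniformly_smooth X \<and>
     1 < p \<and> 1 < q \<and> 1 / p + 1 / q = 1"

text \<open>Strong measurability: almost everywhere limit of simple functions supported on sets of
  finite measure. (Borel measurability would not be adequate, as \<open>'x\<close> need not be separable.)\<close>

definition strongly_measurable :: "'s measure \<Rightarrow> ('s \<Rightarrow> 'x::real_normed_vector) \<Rightarrow> bool" where
  "strongly_measurable M f \<longleftrightarrow>
     (\<exists>u. (\<forall>i::nat. simple_function M (u i) \<and> emeasure M {s \<in> space M. u i s \<noteq> 0} < \<infinity>) \<and>
          (AE s in M. (\<lambda>i. u i s) \<longlonglongrightarrow> f s))"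

definition Lp_fun :: "'s measure \<Rightarrow> real \<Rightarrow> ('s \<Rightarrow> 'x::real_normed_vector) set" where
  "Lp_fun M p = {f. strongly_measurable M f \<and> integrable M (\<lambda>s. norm (f s) powr p)}"

definition Lp_rel ::
    "'s measure \<Rightarrow> real \<Rightarrow> (('s \<Rightarrow> 'x::real_normed_vector) \<times> ('s \<Rightarrow> 'x)) set" where
  "Lp_rel M p = {(f, g). f \<in> Lp_fun M p \<and> g \<in> Lp_fun M p \<and> (AE s in M. f s = g s)}"

text \<open>Elements of \<open>L\<^sub>p(M; 'x)\<close> are equivalence classes of functions; operations are performed on
  arbitrarily chosen representatives.\<close>

definition Lp :: "'s measure \<Rightarrow> real \<Rightarrow> ('s \<Rightarrow> 'x::real_normed_vector) set set" where
  "Lp M p = Lp_fun M p // Lp_rel M p"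

definition Lp_class ::
    "'s measure \<Rightarrow> real \<Rightarrow> ('s \<Rightarrow> 'x::real_normed_vector) \<Rightarrow> ('s \<Rightarrow> 'x) set" where
  "Lp_class M p f = Lp_rel M p `` {f}"

definition Lp_rep :: "('s \<Rightarrow> 'x) set \<Rightarrow> 's \<Rightarrow> 'x" where
  "Lp_rep F = (SOME f. f \<in> F)"

definition Lp_zero :: "'s measure \<Rightarrow> real \<Rightarrow> ('s \<Rightarrow> 'x::real_normed_vector) set" where
  "Lp_zero M p = Lp_class M p (\<lambda>s. 0)"

definition Lp_plus ::
    "'s measure \<Rightarrow> real \<Rightarrow> ('s \<Rightarrow> 'x::real_normed_vector) set \<Rightarrow> ('s \<Rightarrow> 'x) set \<Rightarrow> ('s \<Rightarrow> 'x) set" where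
  "Lp_plus M p F G = Lp_class M p (\<lambda>s. Lp_rep F s + Lp_rep G s)"

definition Lp_minus ::
    "'s measure \<Rightarrow> real \<Rightarrow> ('s \<Rightarrow> 'x::real_normed_vector) set \<Rightarrow> ('s \<Rightarrow> 'x) set \<Rightarrow> ('s \<Rightarrow> 'x) set" where
  "Lp_minus M p F G = Lp_class M p (\<lambda>s. Lp_rep F s - Lp_rep G s)"

definition Lp_scale ::
    "'s measure \<Rightarrow> real \<Rightarrow> real \<Rightarrow> ('s \<Rightarrow> 'x::real_normed_vector) set \<Rightarrow> ('s \<Rightarrow> 'x) set" where
  "Lp_scale M p c F = Lp_class M p (\<lambda>s. c *\<^sub>R Lp_rep F s)"

definition Lp_norm :: "'s measure \<Rightarrow> real \<Rightarrow> ('s \<Rightarrow> 'x::real_normed_vector) set \<Rightarrow> real" where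
  "Lp_norm M p F = (\<integral>s. norm (Lp_rep F s) powr p \<partial>M) powr (1 / p)"

definition Lp_dist ::
    "'s measure \<Rightarrow> real \<Rightarrow> ('s \<Rightarrow> 'x::real_normed_vector) set \<Rightarrow> ('s \<Rightarrow> 'x) set \<Rightarrow> real" where
  "Lp_dist M p F G = Lp_norm M p (Lp_minus M p F G)"

definition Lp_topology ::
    "'s measure \<Rightarrow> real \<Rightarrow> ('s \<Rightarrow> 'x::real_normed_vector) set topology" where
  "Lp_topology M p = Metric_space.mtopology (Lp M p) (Lp_dist M p)"

definition Lp_convex :: "'s measure \<Rightarrow> real \<Rightarrow> ('s \<Rightarrow> 'x::real_normed_vector) set set \<Rightarrow> bool" where
  "Lp_convex M p K \<longleftrightarrow> K \<subseteq> Lp M p \<and>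
     (\<forall>F\<in>K. \<forall>G\<in>K. \<forall>u\<ge>0. \<forall>v\<ge>0. u + v = 1
        \<longrightarrow> Lp_plus M p (Lp_scale M p u F) (Lp_scale M p v G) \<in> K)"

definition Lp_cone ::
    "'s measure \<Rightarrow> real \<Rightarrow> ('s \<Rightarrow> 'x::real_normed_vector) set \<Rightarrow> ('s \<Rightarrow> 'x) set set \<Rightarrow> bool" where
  "Lp_cone M p V K \<longleftrightarrow> K \<noteq> {} \<and> K \<subseteq> Lp M p \<and>
     (\<forall>G\<in>K. \<forall>t\<ge>0. Lp_plus M p V (Lp_scale M p t (Lp_minus M p G V)) \<in> K)"

definition Lp_pairing ::
    "'s measure \<Rightarrow> ('s \<Rightarrow> ('x::real_normed_vector \<Rightarrow>\<^sub>L real)) set \<Rightarrow> ('s \<Rightarrow> 'x) set \<Rightarrow> real" where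
  "Lp_pairing M \<Phi> F = (\<integral>s. blinfun_apply (Lp_rep \<Phi> s) (Lp_rep F s) \<partial>M)"

definition duality_map ::
    "'s measure \<Rightarrow> real \<Rightarrow> real \<Rightarrow> ('s \<Rightarrow> 'x::real_normed_vector) set
       \<Rightarrow> ('s \<Rightarrow> ('x \<Rightarrow>\<^sub>L real)) set" where
  "duality_map M p q F = (THE \<Phi>. \<Phi> \<in> Lp M q \<and>
     Lp_pairing M \<Phi> F = Lp_norm M q \<Phi> * Lp_norm M p F \<and>
     Lp_norm M q \<Phi> * Lp_norm M p F = (Lp_norm M p F)\<^sup>2 \<and>
     (Lp_norm M p F)\<^sup>2 = (Lp_norm M q \<Phi>)\<^sup>2)"

text \<open>The set \<open>S\<^sub>C\<^sup>-\<^sup>*(G)\<close>; the supremum may be infinite, hence is taken in the extended reals.\<close>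

definition inv_support_set ::
    "'s measure \<Rightarrow> real \<Rightarrow> real \<Rightarrow> ('s \<Rightarrow> 'x::real_normed_vector) set set \<Rightarrow> ('s \<Rightarrow> 'x) set
       \<Rightarrow> ('s \<Rightarrow> 'x) set set" where
  "inv_support_set M p q C G = {H \<in> Lp M p.
     ereal (Lp_pairing M (duality_map M p q H) G) =
       (SUP F\<in>C. ereal (Lp_pairing M (duality_map M p q H) F))}"

end

theory Submission
  imports Defs
begin

text \<open>
  The inverse support set of \<open>C\<close> at \<open>G\<close> consists of the \<open>H\<close> such that the pairing of \<open>J\<^sub>p H\<close> with
  \<open>F - G\<close> is nonpositive for every \<open>F\<close> in \<open>C\<close>. The duality mapping is not linear, so a direct approach
  has to establish its homogeneity and some continuity. Instead, the duality mapping is eliminated: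
  as \<open>J\<^sub>p H\<close> is the gradient of the convex function \<open>\<parallel>H\<parallel>\<^sup>2 / 2\<close>, the pairing of \<open>J\<^sub>p H\<close> with \<open>K\<close> is
  nonpositive if and only if moving from \<open>H\<close> in the direction \<open>- K\<close> never decreases the norm,

  \<open>\<parallel>H\<parallel> \<le> \<parallel>H - t K\<parallel>\<close> for all \<open>t \<ge> 0\<close>

  (lemma \<open>pairing_Lp_dual_nonpos_iff\<close>). The inverse support set is therefore cut out by inequalities
  between norms (lemma \<open>inv_support_set_iff\<close>). In this form everything positive is immediate: the
  origin satisfies all the inequalities, each of them is closed in \<open>H\<close>, and scaling \<open>H\<close> by \<open>c > 0\<close> only
  rescales the parameter \<open>t\<close>.

  The work lies in showing that the duality mapping, given by a definite description, is what it
  should be. For a uniformly smooth norm on \<open>X\<close> the right derivative at \<open>x \<noteq> 0\<close> is a bounded linear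
  functional supporting \<open>x\<close>; Smulian's criterion (lemma \<open>Smulian\<close>) shows that it is the only one and
  depends continuously on \<open>x\<close>. Continuity makes \<open>s \<mapsto> \<parallel>h s\<parallel>\<^sup>p\<^sup>-\<^sup>1 j (h s)\<close>, with \<open>j x\<close> the support functional
  of \<open>x\<close>, strongly measurable for \<open>h\<close> in \<open>L\<^sub>p\<close>; multiplied by \<open>\<parallel>h\<parallel>\<^sup>2\<^sup>-\<^sup>p\<close> it has the properties that
  define \<open>J\<^sub>p h\<close>. Uniqueness comes from the equality case of Young's inequality (lemma
  \<open>Lp_dual_unique\<close>). The differentiability of the \<open>L\<^sub>p\<close> norm which the norm characterization needs is
  an application of dominated convergence.

  Convexity fails because \<open>J\<^sub>p\<close> is not linear. For real functions on three points and exponent 4, take for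
  \<open>C\<close> the line spanned by \<open>(1, 1, -1)\<close>: its inverse support set at 0 is the cubic cone
  \<open>h\<^sub>0\<^sup>3 + h\<^sub>1\<^sup>3 = h\<^sub>2\<^sup>3\<close>, which is not convex.
\<close>

section \<open>Strongly measurable functions\<close>

text \<open>The condition \<open>h 0 0 = 0\<close> keeps the approximating simple functions supported on sets of finite
measure. Sums, norms, duality pairings and the duality mapping are all instances.\<close>

lemma strongly_measurable_compose2:
  fixes h :: "'x::real_normed_vector \<Rightarrow> 'y::real_normed_vector \<Rightarrow> 'z::real_normed_vector"
  assumes f: "strongly_measurable M f" and g: "strongly_measurable M g"
    and h: "continuous_on UNIV (\<lambda>z. h (fst z) (snd z))" and h0: "h 0 0 = 0"
  shows "strongly_measurable M (\<lambda>s. h (f s) (g s))"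
proof -
  obtain u where u: "\<And>i::nat. simple_function M (u i)"
      "\<And>i. emeasure M {s \<in> space M. u i s \<noteq> 0} < \<infinity>" "AE s in M. (\<lambda>i. u i s) \<longlonglongrightarrow> f s"
    using f unfolding strongly_measurable_def by blast
  obtain v where v: "\<And>i::nat. simple_function M (v i)"
      "\<And>i. emeasure M {s \<in> space M. v i s \<noteq> 0} < \<infinity>" "AE s in M. (\<lambda>i. v i s) \<longlonglongrightarrow> g s"
    using g unfolding strongly_measurable_def by blast
  have sim: "simple_function M (\<lambda>s. h (u i s) (v i s))" for i
    by (rule simple_function_compose2[OF u(1) v(1)])
  have fin: "emeasure M {s \<in> space M. h (u i s) (v i s) \<noteq> 0} < \<infinity>" for i
  proof -
    have [measurable]: "{s \<in> space M. u i s \<noteq> 0} \<in> sets M" "{s \<in> space M. v i s \<noteq> 0} \<in> sets M"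
    proof -
      have "{s \<in> space M. u i s \<noteq> 0} = u i -` (- {0}) \<inter> space M"
          "{s \<in> space M. v i s \<noteq> 0} = v i -` (- {0}) \<inter> space M" by auto
      then show "{s \<in> space M. u i s \<noteq> 0} \<in> sets M" "{s \<in> space M. v i s \<noteq> 0} \<in> sets M"
        by (simp_all only: simple_functionD(2)[OF u(1)] simple_functionD(2)[OF v(1)])
    qed
    have "{s \<in> space M. h (u i s) (v i s) \<noteq> 0} \<subseteq>
        {s \<in> space M. u i s \<noteq> 0} \<union> {s \<in> space M. v i s \<noteq> 0}"
      using h0 by auto
    then have "emeasure M {s \<in> space M. h (u i s) (v i s) \<noteq> 0} \<le>
        emeasure M ({s \<in> space M. u i s \<noteq> 0} \<union> {s \<in> space M. v i s \<noteq> 0})"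
      by (intro emeasure_mono) measurable
    also have "\<dots> \<le> emeasure M {s \<in> space M. u i s \<noteq> 0} + emeasure M {s \<in> space M. v i s \<noteq> 0}"
      by (intro emeasure_subadditive) measurable
    also have "\<dots> < \<infinity>"
      using u(2)[of i] v(2)[of i] by (simp add: ennreal_add_less_top)
    finally show ?thesis .
  qed
  have lim: "AE s in M. (\<lambda>i. h (u i s) (v i s)) \<longlonglongrightarrow> h (f s) (g s)"
    using u(3) v(3)
  proof eventually_elim
    case (elim s)
    have "isCont (\<lambda>z. h (fst z) (snd z)) (f s, g s)"
      using h by (simp add: continuous_on_eq_continuous_at)
    from isCont_tendsto_compose[OF this tendsto_Pair[OF elim]] show ?case
      by simp
  qed
  show ?thesis
    unfolding strongly_measurable_def
    by (intro exI[of _ "\<lambda>i s. h (u i s) (v i s)"] conjI allI sim fin lim)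
qed

lemma strongly_measurable_compose:
  fixes h :: "'x::real_normed_vector \<Rightarrow> 'z::real_normed_vector"
  assumes "strongly_measurable M f" "continuous_on UNIV h" "h 0 = 0"
  shows "strongly_measurable M (\<lambda>s. h (f s))"
  by (rule strongly_measurable_compose2[where h = "\<lambda>x y. h x", OF assms(1) assms(1)])
     (use assms in \<open>auto intro!: continuous_on_compose2[OF assms(2)] continuous_intros\<close>)

lemma strongly_measurable_0: "strongly_measurable M (\<lambda>s. 0)"
  unfolding strongly_measurable_def by (rule exI[of _ "\<lambda>i s. 0"]) auto

text \<open>Strong measurability only controls the function almost everywhere; completeness of the measure
turns this into measurability.\<close>

lemma (in complete_measure) borel_measurable_strongly_measurable:
  fixes f :: "'a \<Rightarrow> real"
  assumes "strongly_measurable M f"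
  shows "f \<in> borel_measurable M"
proof -
  obtain u where u: "\<And>i::nat. simple_function M (u i)" "AE s in M. (\<lambda>i. u i s) \<longlonglongrightarrow> f s"
    using assms unfolding strongly_measurable_def by blast
  define l where "l s = lim (\<lambda>i. u i s)" for s
  have [measurable]: "u i \<in> borel_measurable M" for i
    by (rule borel_measurable_simple_function[OF u(1)])
  have l: "l \<in> borel_measurable M"
    unfolding l_def by measurable
  have eq: "AE s in M. l s = f s"
    using u(2) by eventually_elim (auto simp: l_def limI)
  show ?thesis
  proof (rule measurableI)
    fix B :: "real set" assume "B \<in> sets borel"
    then have "l -` B \<inter> space M \<in> sets M"
      using l by (rule measurable_sets[rotated])
    then show "f -` B \<inter> space M \<in> sets M"
    proof (rule in_sets_AE[rotated])
      show "AE s in M. s \<in> l -` B \<inter> space M \<longleftrightarrow> s \<in> f -` B \<inter> space M"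
        using eq by eventually_elim auto
    qed auto
  qed simp
qed

section \<open>Hoelder and Minkowski inequalities\<close>

text \<open>The norm before passing to classes. Analytic statements below concern functions, and are
transferred to classes only at the end.\<close>

definition Lp_seminorm :: "'s measure \<Rightarrow> real \<Rightarrow> ('s \<Rightarrow> 'x::real_normed_vector) \<Rightarrow> real" where
  "Lp_seminorm M p f = (\<integral>s. norm (f s) powr p \<partial>M) powr (1 / p)"

lemma Lp_seminorm_nonneg: "0 \<le> Lp_seminorm M p f"
  by (simp add: Lp_seminorm_def)

locale conjugate_exponents = complete_measure M for M :: "'s measure" +
  fixes p q :: real
  assumes p: "1 < p" and q: "1 < q" and pq: "1 / p + 1 / q = 1"
begin

lemma conj_mult: "(p - 1) * q = p"
proof -
  have "q + p = p * q"
    using p q pq by (simp add: divide_simps)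
  then show ?thesis
    by (simp add: left_diff_distrib)
qed

lemma conjugate_exponents_swap: "conjugate_exponents M q p"
  using p q pq by unfold_locales auto

lemma Lp_seminorm_powr: "Lp_seminorm M p f powr p = (\<integral>s. norm (f s) powr p \<partial>M)"
  using p by (simp add: Lp_seminorm_def powr_powr)

lemma Lp_fun_measurable:
  assumes "f \<in> Lp_fun M r"
  shows "(\<lambda>s. norm (f s)) \<in> borel_measurable M"
  by (rule borel_measurable_strongly_measurable, rule strongly_measurable_compose[of _ f])
     (use assms in \<open>auto simp: Lp_fun_def intro!: continuous_intros\<close>)

lemma Lp_fun_0: "(\<lambda>s. 0) \<in> Lp_fun M p"
  by (simp add: Lp_fun_def strongly_measurable_0)

lemma Lp_fun_scale:
  assumes "f \<in> Lp_fun M p" shows "(\<lambda>s. c *\<^sub>R f s) \<in> Lp_fun M p"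
proof -
  have "strongly_measurable M (\<lambda>s. c *\<^sub>R f s)"
    by (rule strongly_measurable_compose[of M f])
       (use assms in \<open>auto simp: Lp_fun_def intro!: continuous_intros\<close>)
  then show ?thesis
    using assms by (simp add: Lp_fun_def powr_mult)
qed

lemma powr_sum_le:
  fixes a b :: real
  assumes "0 \<le> a" "0 \<le> b" shows "(a + b) powr p \<le> 2 powr p * (a powr p + b powr p)"
proof -
  have "(a + b) powr p \<le> (2 * max a b) powr p"
    using p assms by (intro powr_mono2) auto
  also have "\<dots> = 2 powr p * max a b powr p"
    using assms by (simp add: powr_mult)
  also have "\<dots> \<le> 2 powr p * (a powr p + b powr p)"
    by (intro mult_left_mono) (auto simp: max_def)
  finally show ?thesis .
qed

lemma Lp_fun_add:
  assumes f: "f \<in> Lp_fun M p" and g: "g \<in> Lp_fun M p"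
  shows "(\<lambda>s. f s + g s) \<in> Lp_fun M p"
proof -
  have sm: "strongly_measurable M (\<lambda>s. f s + g s)"
    by (rule strongly_measurable_compose2)
       (use f g in \<open>auto simp: Lp_fun_def intro!: continuous_intros\<close>)
  have [measurable]: "(\<lambda>s. norm (f s + g s)) \<in> borel_measurable M"
    by (rule borel_measurable_strongly_measurable, rule strongly_measurable_compose[OF sm])
       (auto intro!: continuous_intros)
  have "integrable M (\<lambda>s. norm (f s + g s) powr p)"
  proof (rule Bochner_Integration.integrable_bound)
    show "integrable M (\<lambda>s. 2 powr p * (norm (f s) powr p + norm (g s) powr p))"
      using f g by (auto simp: Lp_fun_def)
    show "AE s in M. norm (norm (f s + g s) powr p)
        \<le> norm (2 powr p * (norm (f s) powr p + norm (g s) powr p))"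
    proof (rule AE_I2)
      fix s
      have "norm (f s + g s) powr p \<le> (norm (f s) + norm (g s)) powr p"
        using p by (intro powr_mono2) (auto simp: norm_triangle_ineq)
      with powr_sum_le[of "norm (f s)" "norm (g s)"]
      show "norm (norm (f s + g s) powr p)
        \<le> norm (2 powr p * (norm (f s) powr p + norm (g s) powr p))"
        by simp
    qed
  qed measurable
  with sm show ?thesis
    by (simp add: Lp_fun_def)
qed

lemma Lp_fun_diff:
  assumes f: "f \<in> Lp_fun M p" and g: "g \<in> Lp_fun M p"
  shows "(\<lambda>s. f s - g s) \<in> Lp_fun M p"
  using Lp_fun_add[OF f Lp_fun_scale[OF g, of "-1"]] by simp

lemma Lp_seminorm_scale: "Lp_seminorm M p (\<lambda>s. c *\<^sub>R f s) = \<bar>c\<bar> * Lp_seminorm M p f"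
  using p by (simp add: Lp_seminorm_def powr_mult powr_powr)

lemma Lp_seminorm_cong_AE:
  assumes "f \<in> Lp_fun M p" "g \<in> Lp_fun M p" "AE s in M. f s = g s"
  shows "Lp_seminorm M p f = Lp_seminorm M p g"
proof -
  have "(\<integral>s. norm (f s) powr p \<partial>M) = (\<integral>s. norm (g s) powr p \<partial>M)"
    by (rule integral_cong_AE) (use assms in \<open>auto simp: Lp_fun_def elim: eventually_mono\<close>)
  then show ?thesis
    by (simp add: Lp_seminorm_def)
qed

lemma Lp_seminorm_eq_0_iff:
  assumes "f \<in> Lp_fun M p"
  shows "Lp_seminorm M p f = 0 \<longleftrightarrow> (AE s in M. f s = 0)"
proof -
  have "Lp_seminorm M p f = 0 \<longleftrightarrow> (\<integral>s. norm (f s) powr p \<partial>M) = 0"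
    by (simp add: Lp_seminorm_def)
  also have "\<dots> \<longleftrightarrow> (AE s in M. norm (f s) powr p = 0)"
    using assms by (intro integral_nonneg_eq_0_iff_AE) (auto simp: Lp_fun_def)
  finally show ?thesis by simp
qed

lemma Hoelder_integrable:
  fixes a b :: "'s \<Rightarrow> real"
  assumes [measurable]: "a \<in> borel_measurable M" "b \<in> borel_measurable M"
    and nn: "\<And>s. 0 \<le> a s" "\<And>s. 0 \<le> b s"
    and int: "integrable M (\<lambda>s. a s powr p)" "integrable M (\<lambda>s. b s powr q)"
  shows "integrable M (\<lambda>s. a s * b s)"
proof (rule Bochner_Integration.integrable_bound)
  show "integrable M (\<lambda>s. a s powr p / p + b s powr q / q)"
    using int by auto
  show "AE s in M. norm (a s * b s) \<le> norm (a s powr p / p + b s powr q / q)"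
  proof (rule AE_I2)
    fix s
    have "a s * b s \<le> a s powr p / p + b s powr q / q" "0 \<le> a s powr p / p + b s powr q / q"
      using p q pq nn by (auto intro!: Youngs_inequality)
    then show "norm (a s * b s) \<le> norm (a s powr p / p + b s powr q / q)"
      using nn by simp
  qed
qed measurable

text \<open>Integrate Young's inequality for \<open>a / A\<close> and \<open>b / B\<close>, where \<open>A\<close> and \<open>B\<close> are the norms: the
right-hand side integrates to \<open>1 / p + 1 / q = 1\<close>.\<close>

lemma Hoelder_integral:
  fixes a b :: "'s \<Rightarrow> real"
  assumes [measurable]: "a \<in> borel_measurable M" "b \<in> borel_measurable M"
    and nn: "\<And>s. 0 \<le> a s" "\<And>s. 0 \<le> b s"
    and int: "integrable M (\<lambda>s. a s powr p)" "integrable M (\<lambda>s. b s powr q)"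
  shows "(\<integral>s. a s * b s \<partial>M) \<le> Lp_seminorm M p a * Lp_seminorm M q b"
proof -
  define A where "A = Lp_seminorm M p a"
  define B where "B = Lp_seminorm M q b"
  have A: "A powr p = (\<integral>s. a s powr p \<partial>M)" and B: "B powr q = (\<integral>s. b s powr q \<partial>M)"
    using p q nn by (auto simp: A_def B_def Lp_seminorm_def powr_powr)
  have A0: "0 \<le> A" and B0: "0 \<le> B" by (auto simp: A_def B_def Lp_seminorm_nonneg)
  show ?thesis
  proof (cases "A = 0 \<or> B = 0")
    case True
    have "AE s in M. a s * b s = 0"
      using True
    proof
      assume "A = 0"
      then have "(\<integral>s. a s powr p \<partial>M) = 0" using A by simp
      then have "AE s in M. a s powr p = 0"
        using int(1) by (subst (asm) integral_nonneg_eq_0_iff_AE) auto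
      then show ?thesis by eventually_elim auto
    next
      assume "B = 0"
      then have "(\<integral>s. b s powr q \<partial>M) = 0" using B by simp
      then have "AE s in M. b s powr q = 0"
        using int(2) by (subst (asm) integral_nonneg_eq_0_iff_AE) auto
      then show ?thesis by eventually_elim auto
    qed
    then have "(\<integral>s. a s * b s \<partial>M) = 0"
      using integral_cong_AE[of "\<lambda>s. a s * b s" M "\<lambda>s. 0"] by simp
    then show ?thesis
      using A0 B0 by (simp add: A_def B_def)
  next
    case False
    then have AB: "0 < A" "0 < B" using A0 B0 by auto
    have "(\<integral>s. a s * b s \<partial>M) / (A * B) = (\<integral>s. (a s / A) * (b s / B) \<partial>M)"
      by simp
    also have "\<dots> \<le> (\<integral>s. (a s powr p / A powr p) / p + (b s powr q / B powr q) / q \<partial>M)"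
    proof (rule integral_mono)
      show "integrable M (\<lambda>s. (a s / A) * (b s / B))"
        using Hoelder_integrable[OF assms] by simp
      show "(a s / A) * (b s / B) \<le> (a s powr p / A powr p) / p + (b s powr q / B powr q) / q" for s
        using Youngs_inequality[OF p q pq, of "a s / A" "b s / B"] nn[of s] AB
        by (simp add: powr_divide)
    qed (use int in auto)
    also have "\<dots> = 1"
      using int pq AB by (simp flip: A B)
    finally show ?thesis
      using AB by (simp add: A_def B_def field_simps)
  qed
qed

lemma powr_conj_seminorm:
  fixes w :: "'s \<Rightarrow> real"
  assumes "\<And>s. 0 \<le> w s"
  shows "Lp_seminorm M q (\<lambda>s. w s powr (p - 1)) = Lp_seminorm M p w powr (p - 1)"
proof -
  have "1 / q = (p - 1) / p"
    using p pq by (simp add: diff_divide_distrib)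
  then show ?thesis
    using assms p by (simp add: Lp_seminorm_def powr_powr conj_mult)
qed

text \<open>With \<open>w = \<parallel>f + g\<parallel>\<close>, bound one factor of \<open>w\<^sup>p = w w\<^sup>p\<^sup>-\<^sup>1\<close> by \<open>\<parallel>f\<parallel> + \<parallel>g\<parallel>\<close> and apply
Hoelder's inequality to both products. The \<open>L\<^sub>q\<close> norm of \<open>w\<^sup>p\<^sup>-\<^sup>1\<close> is \<open>\<parallel>w\<parallel>\<^sup>p\<^sup>-\<^sup>1\<close>, which can be
cancelled.\<close>

lemma Lp_seminorm_triangle:
  fixes f g :: "'s \<Rightarrow> 'x::real_normed_vector"
  assumes f: "f \<in> Lp_fun M p" and g: "g \<in> Lp_fun M p"
  shows "Lp_seminorm M p (\<lambda>s. f s + g s) \<le> Lp_seminorm M p f + Lp_seminorm M p g"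
proof -
  define w where "w s = norm (f s + g s)" for s
  note h = Lp_fun_add[OF f g]
  have [measurable]: "w \<in> borel_measurable M" "(\<lambda>s. norm (f s)) \<in> borel_measurable M"
      "(\<lambda>s. norm (g s)) \<in> borel_measurable M"
    using Lp_fun_measurable[OF f] Lp_fun_measurable[OF g] Lp_fun_measurable[OF h]
    by (auto simp: w_def[abs_def])
  have intw: "integrable M (\<lambda>s. w s powr p)"
    using h by (auto simp: Lp_fun_def w_def)
  have intq: "integrable M (\<lambda>s. (w s powr (p - 1)) powr q)"
    using intw by (simp add: powr_powr conj_mult)
  have w0: "0 \<le> w s" for s by (simp add: w_def)
  define W where "W = Lp_seminorm M p w"
  have W: "W powr p = (\<integral>s. w s powr p \<partial>M)" "W = Lp_seminorm M p (\<lambda>s. f s + g s)"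
    using w0 p by (auto simp: W_def Lp_seminorm_def powr_powr w_def)
  have H: "integrable M (\<lambda>s. norm (k s) * w s powr (p - 1))"
       "(\<integral>s. norm (k s) * w s powr (p - 1) \<partial>M) \<le> Lp_seminorm M p k * W powr (p - 1)"
    if k: "k \<in> Lp_fun M p" for k :: "'s \<Rightarrow> 'x"
  proof -
    have [measurable]: "(\<lambda>s. norm (k s)) \<in> borel_measurable M"
      by (rule Lp_fun_measurable[OF k])
    show "integrable M (\<lambda>s. norm (k s) * w s powr (p - 1))"
      using k intq by (intro Hoelder_integrable) (auto simp: Lp_fun_def)
    have "(\<integral>s. norm (k s) * w s powr (p - 1) \<partial>M)
        \<le> Lp_seminorm M p (\<lambda>s. norm (k s)) * Lp_seminorm M q (\<lambda>s. w s powr (p - 1))"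
      using k intq by (intro Hoelder_integral) (auto simp: Lp_fun_def)
    then show "(\<integral>s. norm (k s) * w s powr (p - 1) \<partial>M) \<le> Lp_seminorm M p k * W powr (p - 1)"
      by (simp add: powr_conj_seminorm[OF w0] W_def) (simp add: Lp_seminorm_def)
  qed
  have "W powr p \<le> (\<integral>s. norm (f s) * w s powr (p - 1) + norm (g s) * w s powr (p - 1) \<partial>M)"
    unfolding W(1)
  proof (rule integral_mono)
    show "w s powr p \<le> norm (f s) * w s powr (p - 1) + norm (g s) * w s powr (p - 1)" for s
    proof -
      have "w s powr p = w s * w s powr (p - 1)"
        using w0[of s] by (cases "w s = 0") (auto simp: powr_mult_base)
      also have "\<dots> \<le> (norm (f s) + norm (g s)) * w s powr (p - 1)"
        by (intro mult_right_mono) (auto simp: w_def norm_triangle_ineq)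
      finally show ?thesis by (simp add: distrib_right)
    qed
  qed (use intw H(1)[OF f] H(1)[OF g] in auto)
  also have "\<dots> \<le> (Lp_seminorm M p f + Lp_seminorm M p g) * W powr (p - 1)"
    using H[OF f] H[OF g] by (simp add: distrib_right)
  finally have *: "W * W powr (p - 1) \<le> (Lp_seminorm M p f + Lp_seminorm M p g) * W powr (p - 1)"
    by (cases "W = 0") (auto simp: powr_mult_base W_def Lp_seminorm_nonneg)
  show ?thesis
  proof (cases "W = 0")
    case True then show ?thesis by (simp add: W(2)[symmetric] Lp_seminorm_nonneg)
  next
    case False
    then show ?thesis using * by (simp add: W(2))
  qed
qed

end

section \<open>Support functionals of a uniformly smooth norm\<close>

text \<open>The right derivative of the norm at \<open>x\<close> in direction \<open>y\<close>. By convexity the difference quotients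
decrease as \<open>t\<close> decreases to 0, so that the limit is an infimum. It is always sublinear in
\<open>y\<close>; smoothness makes it odd, hence linear. This yields support functionals explicitly, without an
extension theorem.\<close>

definition norm_deriv :: "'x::real_normed_vector \<Rightarrow> 'x \<Rightarrow> real" where
  "norm_deriv x y = (INF t\<in>{0<..}. (norm (x + t *\<^sub>R y) - norm x) / t)"

lemma norm_quotient_mono:
  fixes x y :: "'x::real_normed_vector"
  assumes "0 < s" "s \<le> t"
  shows "(norm (x + s *\<^sub>R y) - norm x) / s \<le> (norm (x + t *\<^sub>R y) - norm x) / t"
proof -
  have "x + s *\<^sub>R y = (1 - s / t) *\<^sub>R x + (s / t) *\<^sub>R (x + t *\<^sub>R y)"
    using assms by (simp add: algebra_simps)
  then have "norm (x + s *\<^sub>R y) \<le> norm ((1 - s / t) *\<^sub>R x) + norm ((s / t) *\<^sub>R (x + t *\<^sub>R y))"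
    by (simp only: norm_triangle_ineq)
  also have "\<dots> = (1 - s / t) * norm x + (s / t) * norm (x + t *\<^sub>R y)"
    using assms by simp
  finally have "norm (x + s *\<^sub>R y) - norm x \<le> s * ((norm (x + t *\<^sub>R y) - norm x) / t)"
    by (simp add: algebra_simps diff_divide_distrib)
  then show ?thesis
    using assms by (simp add: pos_divide_le_eq mult.commute)
qed

lemma norm_quotient_bound:
  fixes x y :: "'x::real_normed_vector"
  assumes "0 < t" shows "- norm y \<le> (norm (x + t *\<^sub>R y) - norm x) / t"
proof -
  have "norm x \<le> norm (x + t *\<^sub>R y) + t * norm y"
    using norm_triangle_ineq4[of "x + t *\<^sub>R y" "t *\<^sub>R y"] assms by simp
  then show ?thesis
    using assms by (simp add: pos_le_divide_eq algebra_simps)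
qed

lemma bdd_below_norm_quotient:
  fixes x y :: "'x::real_normed_vector"
  shows "bdd_below ((\<lambda>t. (norm (x + t *\<^sub>R y) - norm x) / t) ` {0<..})"
  by (rule bdd_belowI2[of _ "- norm y"]) (auto intro: norm_quotient_bound)

lemma norm_deriv_le: "0 < t \<Longrightarrow> norm_deriv x y \<le> (norm (x + t *\<^sub>R y) - norm x) / t"
  unfolding norm_deriv_def by (rule cINF_lower[OF bdd_below_norm_quotient]) auto

lemma norm_deriv_ge: "(\<And>t. 0 < t \<Longrightarrow> c \<le> (norm (x + t *\<^sub>R y) - norm x) / t) \<Longrightarrow> c \<le> norm_deriv x y"
  unfolding norm_deriv_def by (rule cINF_greatest) auto

lemma norm_deriv_le_norm: "norm_deriv x y \<le> norm y"
  using norm_deriv_le[of 1 x y] norm_triangle_ineq[of x y] by simp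

lemma norm_deriv_add: "norm_deriv x (y + z) \<le> norm_deriv x y + norm_deriv x z"
proof -
  \<comment> \<open>The two infima are over independent step sizes; monotonicity of the quotients allows to pass
    to a common step.\<close>
  have 1: "norm_deriv x (y + z) \<le>
      (norm (x + s *\<^sub>R y) - norm x) / s + (norm (x + t *\<^sub>R z) - norm x) / t" if "0 < s" "0 < t" for s t
  proof -
    define r where "r = min s t"
    have r: "0 < r" "r \<le> s" "r \<le> t" using that by (auto simp: r_def)
    have "x + (r / 2) *\<^sub>R (y + z) = (1 / 2) *\<^sub>R (x + r *\<^sub>R y) + (1 / 2) *\<^sub>R (x + r *\<^sub>R z)"
      by (simp add: algebra_simps flip: scaleR_add_left)
    then have "norm (x + (r / 2) *\<^sub>R (y + z)) \<le>
        norm ((1 / 2) *\<^sub>R (x + r *\<^sub>R y)) + norm ((1 / 2) *\<^sub>R (x + r *\<^sub>R z))"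
      by (simp only: norm_triangle_ineq)
    then have "norm (x + (r / 2) *\<^sub>R (y + z)) - norm x \<le>
        (norm (x + r *\<^sub>R y) - norm x) / 2 + (norm (x + r *\<^sub>R z) - norm x) / 2"
      by (simp add: diff_divide_distrib)
    then have "(norm (x + (r / 2) *\<^sub>R (y + z)) - norm x) / (r / 2) \<le>
        (norm (x + r *\<^sub>R y) - norm x) / r + (norm (x + r *\<^sub>R z) - norm x) / r"
      using r by (simp only: flip: add_divide_distrib) (simp add: divide_right_mono)
    with norm_deriv_le[of "r / 2" x "y + z"] r
      norm_quotient_mono[OF r(1,2), of x y] norm_quotient_mono[OF r(1,3), of x z]
    show ?thesis by linarith
  qed
  have "norm_deriv x (y + z) - (norm (x + s *\<^sub>R y) - norm x) / s \<le> norm_deriv x z" if "0 < s" for s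
    using 1[OF that] by (intro norm_deriv_ge) (simp add: diff_le_eq add.commute)
  then have "norm_deriv x (y + z) - norm_deriv x z \<le> norm_deriv x y"
    by (intro norm_deriv_ge) (simp add: algebra_simps)
  then show ?thesis by simp
qed

lemma norm_deriv_scale:
  assumes "0 < c" shows "norm_deriv x (c *\<^sub>R y) = c * norm_deriv x y"
proof -
  have le: "norm_deriv x (c *\<^sub>R y) \<le> c * norm_deriv x y" if c: "0 < c" for c :: real and y
  proof -
    have "norm_deriv x (c *\<^sub>R y) / c \<le> norm_deriv x y"
    proof (rule norm_deriv_ge)
      fix t :: real assume "0 < t"
      with norm_deriv_le[of "t / c" x "c *\<^sub>R y"] c
      show "norm_deriv x (c *\<^sub>R y) / c \<le> (norm (x + t *\<^sub>R y) - norm x) / t"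
        by (simp add: field_simps)
    qed
    then show ?thesis using c by (simp add: field_simps)
  qed
  have "norm_deriv x (inverse c *\<^sub>R c *\<^sub>R y) \<le> inverse c * norm_deriv x (c *\<^sub>R y)"
    by (rule le) (use assms in simp)
  with le[OF assms, of y] assms show ?thesis
    by (simp add: field_simps)
qed

lemma norm_deriv_self: "norm_deriv x x = norm x"
proof (rule antisym[OF norm_deriv_le_norm norm_deriv_ge])
  fix t :: real assume t: "0 < t"
  have "x + t *\<^sub>R x = (1 + t) *\<^sub>R x" by (simp add: algebra_simps)
  then have "norm (x + t *\<^sub>R x) = (1 + t) * norm x" using t by simp
  then show "norm x \<le> (norm (x + t *\<^sub>R x) - norm x) / t"
    using t by (simp add: field_simps)
qed

text \<open>The smoothness estimate extends from unit directions \<open>y\<close> to the unit ball, since a shorter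
direction amounts to a smaller step.\<close>

lemma uniformly_smooth_sum_le:
  assumes us: "uniformly_smooth TYPE('x::real_normed_vector)" and e: "0 < e"
  obtains d where "0 < d"
    "\<And>(x::'x) y t. norm x = 1 \<Longrightarrow> norm y \<le> 1 \<Longrightarrow> 0 < t \<Longrightarrow> t < d \<Longrightarrow>
        norm (x + t *\<^sub>R y) + norm (x - t *\<^sub>R y) \<le> 2 + e * t"
proof -
  obtain d where d: "0 < d" "\<And>t (x::'x) y. 0 < t \<Longrightarrow> t < d \<Longrightarrow> norm x = 1 \<Longrightarrow> norm y = 1 \<Longrightarrow>
      (norm (x + t *\<^sub>R y) + norm (x - t *\<^sub>R y)) / 2 - 1 \<le> e / 2 * t"
    using us e unfolding uniformly_smooth_def by (metis half_gt_zero)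
  show ?thesis
  proof (rule that[OF d(1)])
    fix x y :: 'x and t :: real
    assume *: "norm x = 1" "norm y \<le> 1" "0 < t" "t < d"
    show "norm (x + t *\<^sub>R y) + norm (x - t *\<^sub>R y) \<le> 2 + e * t"
    proof (cases "y = 0")
      case True then show ?thesis using * e by simp
    next
      case False
      have ty: "0 < t * norm y" "t * norm y \<le> t"
        using False * mult_left_le[of "norm y" t] by auto
      then have "t * norm y < d" using * by linarith
      have "(norm (x + (t * norm y) *\<^sub>R (y /\<^sub>R norm y)) + norm (x - (t * norm y) *\<^sub>R (y /\<^sub>R norm y))) / 2 - 1
          \<le> e / 2 * (t * norm y)"
        by (rule d(2)) (use ty \<open>t * norm y < d\<close> * False in auto)
      moreover have "e / 2 * (t * norm y) \<le> e / 2 * t"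
        using ty e by (intro mult_left_mono) auto
      moreover have "(t * norm y) *\<^sub>R (y /\<^sub>R norm y) = t *\<^sub>R y"
        using False by simp
      ultimately have "(norm (x + t *\<^sub>R y) + norm (x - t *\<^sub>R y)) / 2 - 1 \<le> e / 2 * t"
        by (simp only:)
      then show ?thesis by (simp add: field_simps)
    qed
  qed
qed

text \<open>The sum of the right derivatives in directions \<open>y\<close> and \<open>- y\<close> is nonnegative by subadditivity,
and at most the second difference quotient of the norm, which smoothness makes arbitrarily small.\<close>

lemma norm_deriv_minus:
  assumes us: "uniformly_smooth TYPE('x::real_normed_vector)" and x: "(x::'x) \<noteq> 0"
  shows "norm_deriv x (- y) = - norm_deriv x y"
proof -
  have "0 \<le> norm_deriv x y + norm_deriv x (- y)"
  proof -
    have "0 \<le> norm_deriv x 0" by (rule norm_deriv_ge) simp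
    then show ?thesis using norm_deriv_add[of x y "- y"] by simp
  qed
  moreover have "norm_deriv x y + norm_deriv x (- y) \<le> e" if e: "0 < e" for e
  proof -
    define n where "n = norm x"
    \<comment> \<open>Only \<open>norm (y / m) \<le> 1\<close> matters; the summand 1 avoids a case distinction for \<open>y = 0\<close>.\<close>
    define m where "m = norm y + 1"
    have nm: "0 < n" "0 < m" using x by (auto simp: n_def m_def add_nonneg_pos)
    have "0 < e / m" using e nm by simp
    then obtain d where d: "0 < d"
      "\<And>(x::'x) y t. norm x = 1 \<Longrightarrow> norm y \<le> 1 \<Longrightarrow> 0 < t \<Longrightarrow> t < d \<Longrightarrow>
        norm (x + t *\<^sub>R y) + norm (x - t *\<^sub>R y) \<le> 2 + e / m * t"
      using uniformly_smooth_sum_le[OF us] by blast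
    define t where "t = d / 2"
    have t: "0 < t" "t < d" using d(1) by (auto simp: t_def)
    have "norm (x /\<^sub>R n + t *\<^sub>R (y /\<^sub>R m)) + norm (x /\<^sub>R n - t *\<^sub>R (y /\<^sub>R m)) \<le> 2 + e / m * t"
      by (rule d(2)[OF _ _ t]) (use nm in \<open>auto simp: n_def m_def divide_simps\<close>)
    define r where "r = n * t / m"
    have r: "0 < r" using nm t by (simp add: r_def)
    have "x /\<^sub>R n + t *\<^sub>R (y /\<^sub>R m) = (x + r *\<^sub>R y) /\<^sub>R n"
         "x /\<^sub>R n - t *\<^sub>R (y /\<^sub>R m) = (x + r *\<^sub>R (- y)) /\<^sub>R n"
      using nm by (auto simp: r_def algebra_simps divide_inverse)
    with \<open>norm (x /\<^sub>R n + _) + _ \<le> _\<close>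
    have "norm (x + r *\<^sub>R y) / n + norm (x + r *\<^sub>R (- y)) / n \<le> 2 + e / m * t"
      using nm by (simp add: divide_inverse mult.commute)
    then have "(norm (x + r *\<^sub>R y) + norm (x + r *\<^sub>R (- y)) - 2 * n) / n \<le> e / m * t"
      using nm by (simp add: add_divide_distrib diff_divide_distrib)
    then have "norm (x + r *\<^sub>R y) + norm (x + r *\<^sub>R (- y)) - 2 * n \<le> e * r"
      using nm by (simp add: pos_divide_le_eq r_def mult_ac)
    then have "(norm (x + r *\<^sub>R y) + norm (x + r *\<^sub>R (- y)) - 2 * n) / r \<le> e"
      using r by (simp add: pos_divide_le_eq)
    then have "(norm (x + r *\<^sub>R y) - n) / r + (norm (x + r *\<^sub>R (- y)) - n) / r \<le> e"
      by (simp add: add_divide_distrib diff_divide_distrib)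
    with norm_deriv_le[OF r, of x y] norm_deriv_le[OF r, of x "- y"] show ?thesis
      by (simp add: n_def)
  qed
  then have "norm_deriv x y + norm_deriv x (- y) \<le> 0"
    by (rule field_le_epsilon[of _ 0, simplified])
  ultimately show ?thesis by simp
qed

lemma support_functional_exists:
  assumes us: "uniformly_smooth TYPE('x::real_normed_vector)"
  shows "\<exists>f. norm f \<le> 1 \<and> blinfun_apply f x = norm (x::'x)"
proof (cases "x = 0")
  case True
  then show ?thesis by (intro exI[of _ 0]) auto
next
  case False
  note minus = norm_deriv_minus[OF us False]
  have add: "norm_deriv x (y + z) = norm_deriv x y + norm_deriv x z" for y z
    using norm_deriv_add[of x y z] norm_deriv_add[of x "- y" "- z"] minus[of y] minus[of z]
      minus[of "y + z"] by simp
  have zero: "norm_deriv x 0 = 0" using minus[of 0] by simp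
  have scale: "norm_deriv x (c *\<^sub>R y) = c *\<^sub>R norm_deriv x y" for c y
    using norm_deriv_scale[of c x y] norm_deriv_scale[of "- c" x y] minus[of "c *\<^sub>R y"] zero
    by (cases c "0::real" rule: linorder_cases) auto
  have bound: "norm (norm_deriv x y) \<le> norm y" for y
    using norm_deriv_le_norm[of x y] norm_deriv_le_norm[of x "- y"] minus[of y] by simp
  have bl: "bounded_linear (norm_deriv x)"
    by (rule bounded_linear_intro[of _ 1]) (use add scale bound in auto)
  show ?thesis
    by (rule exI[of _ "Blinfun (norm_deriv x)"])
       (use bound in \<open>auto simp: bounded_linear_Blinfun_apply[OF bl] norm_deriv_self intro!: norm_blinfun_bound\<close>)
qed

text \<open>Evaluate \<open>f\<close> at \<open>x + t y\<close> and \<open>g\<close> at \<open>x - t y\<close>, bound both values by norms, and add: the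
left-hand side is at least \<open>t (f - g) y + 2 - \<parallel>x - z\<parallel>\<close>, and smoothness bounds the right-hand side by
\<open>2 + e t / 2\<close>. Fixing such a \<open>t\<close> determines how close \<open>z\<close> has to be to \<open>x\<close>. The case
\<open>x = z\<close> gives uniqueness of support functionals; the general case gives their continuity.\<close>

lemma Smulian:
  assumes us: "uniformly_smooth TYPE('x::real_normed_vector)" and e: "0 < e"
  obtains d where "0 < d"
    "\<And>(x::'x) z (f::'x \<Rightarrow>\<^sub>L real) g. norm x = 1 \<Longrightarrow> norm z = 1 \<Longrightarrow> norm (x - z) \<le> d \<Longrightarrow>
        norm f \<le> 1 \<Longrightarrow> norm g \<le> 1 \<Longrightarrow> blinfun_apply f x = 1 \<Longrightarrow> blinfun_apply g z = 1 \<Longrightarrow>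
        norm (f - g) \<le> e"
proof -
  obtain d where d: "0 < d"
    "\<And>(x::'x) y t. norm x = 1 \<Longrightarrow> norm y \<le> 1 \<Longrightarrow> 0 < t \<Longrightarrow> t < d \<Longrightarrow>
        norm (x + t *\<^sub>R y) + norm (x - t *\<^sub>R y) \<le> 2 + e / 2 * t"
    using uniformly_smooth_sum_le[OF us half_gt_zero[OF e]] by blast
  define t where "t = d / 2"
  have t: "0 < t" "t < d" using d(1) by (auto simp: t_def)
  show ?thesis
  proof (rule that[of "e / 2 * t"])
    show "0 < e / 2 * t" using e t by simp
    fix x z :: 'x and f g :: "'x \<Rightarrow>\<^sub>L real"
    assume *: "norm x = 1" "norm z = 1" "norm (x - z) \<le> e / 2 * t" "norm f \<le> 1" "norm g \<le> 1"
      "f x = 1" "g z = 1"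
    have le: "h v \<le> norm v" if "norm h \<le> 1" for h :: "'x \<Rightarrow>\<^sub>L real" and v
      using norm_blinfun[of h v] mult_right_mono[OF that, of "norm v"] by simp
    have one: "(f - g) y \<le> e" if y: "norm y \<le> 1" for y
    proof -
      have "f (x + t *\<^sub>R y) \<le> norm (x + t *\<^sub>R y)" "g (x - t *\<^sub>R y) \<le> norm (x - t *\<^sub>R y)"
        "g (z - x) \<le> norm (x - z)"
        using le[OF *(4), of "x + t *\<^sub>R y"] le[OF *(5), of "x - t *\<^sub>R y"] le[OF *(5), of "z - x"]
        by (simp_all add: norm_minus_commute)
      then have "t * (f - g) y \<le> norm (x + t *\<^sub>R y) + norm (x - t *\<^sub>R y) - 2 + norm (x - z)"
        using * by (simp add: blinfun.bilinear_simps algebra_simps)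
      also have "\<dots> \<le> e / 2 * t + e / 2 * t"
        using d(2)[OF *(1) y t] *(3) by simp
      finally show ?thesis using t by (simp add: mult.commute[of t])
    qed
    show "norm (f - g) \<le> e"
    proof (rule norm_blinfun_bound)
      fix y :: 'x
      show "norm ((f - g) y) \<le> e * norm y"
      proof (cases "y = 0")
        case False
        have "\<bar>(f - g) (y /\<^sub>R norm y)\<bar> \<le> e"
          using one[of "y /\<^sub>R norm y"] one[of "- (y /\<^sub>R norm y)"] False
          by (auto simp: blinfun.bilinear_simps abs_le_iff)
        then show ?thesis using False
          by (simp add: blinfun.scaleR_right abs_mult field_simps)
      qed (simp add: blinfun.zero_right)
    qed (use e in simp)
  qed
qed

definition support_functional :: "'x::real_normed_vector \<Rightarrow> ('x \<Rightarrow>\<^sub>L real)" where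
  "support_functional x = (SOME f. norm f \<le> 1 \<and> blinfun_apply f x = norm x)"

context
  assumes us: "uniformly_smooth TYPE('x::real_normed_vector)"
begin

lemma norm_support_functional: "norm (support_functional (x::'x)) \<le> 1"
  and support_functional_self: "support_functional x x = norm x"
  using someI_ex[OF support_functional_exists[OF us, of x]]
  by (auto simp: support_functional_def)

lemma norm_support_functional_eq:
  assumes "(x::'x) \<noteq> 0" shows "norm (support_functional x) = 1"
proof -
  have "norm x \<le> norm (support_functional x) * norm x"
    using norm_blinfun[of "support_functional x" x] by (simp add: support_functional_self)
  with assms norm_support_functional[of x] show ?thesis by simp
qed

lemma support_functional_unique:
  fixes f :: "'x \<Rightarrow>\<^sub>L real"
  assumes x: "x \<noteq> 0" and f: "norm f \<le> 1" "blinfun_apply f x = norm x"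
  shows "f = support_functional x"
proof -
  have "norm (f - support_functional x) \<le> 0 + e" if e: "0 < e" for e
  proof -
    obtain d where "0 < d" and d: "\<And>(x::'x) z (f::'x \<Rightarrow>\<^sub>L real) g. norm x = 1 \<Longrightarrow> norm z = 1 \<Longrightarrow> norm (x - z) \<le> d \<Longrightarrow>
        norm f \<le> 1 \<Longrightarrow> norm g \<le> 1 \<Longrightarrow> blinfun_apply f x = 1 \<Longrightarrow> blinfun_apply g z = 1 \<Longrightarrow>
        norm (f - g) \<le> e"
      using Smulian[OF us e] by blast
    show ?thesis
      using d[of "x /\<^sub>R norm x" "x /\<^sub>R norm x" f "support_functional x"] x f \<open>0 < d\<close>
        norm_support_functional[of x]
      by (simp add: blinfun.scaleR_right support_functional_self)
  qed
  then have "norm (f - support_functional x) \<le> 0" by (rule field_le_epsilon)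
  then show ?thesis by simp
qed

lemma continuous_on_support_functional:
  "continuous_on (- {0}) (support_functional :: 'x \<Rightarrow> _)"
proof -
  have sc: "support_functional x = support_functional (x /\<^sub>R norm x)" if "(x::'x) \<noteq> 0" for x
    by (rule support_functional_unique[symmetric, OF that])
       (use norm_support_functional support_functional_self[of "x /\<^sub>R norm x"] that in
         \<open>auto simp: blinfun.scaleR_right field_simps\<close>)
  have "continuous_on (sphere 0 1) (support_functional :: 'x \<Rightarrow> _)"
  proof (unfold continuous_on_iff, intro ballI allI impI)
    fix x :: 'x and e :: real assume x: "x \<in> sphere 0 1" and e: "0 < e"
    obtain d where "0 < d" and d: "\<And>(x::'x) z (f::'x \<Rightarrow>\<^sub>L real) g. norm x = 1 \<Longrightarrow> norm z = 1 \<Longrightarrow> norm (x - z) \<le> d \<Longrightarrow>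
        norm f \<le> 1 \<Longrightarrow> norm g \<le> 1 \<Longrightarrow> blinfun_apply f x = 1 \<Longrightarrow> blinfun_apply g z = 1 \<Longrightarrow>
        norm (f - g) \<le> e / 2"
      using Smulian[OF us half_gt_zero[OF e]] by blast
    show "\<exists>d>0. \<forall>x'\<in>sphere 0 1. dist x' x < d \<longrightarrow>
        dist (support_functional x') (support_functional x) < e"
    proof (intro exI[of _ d] conjI ballI impI \<open>0 < d\<close>)
      fix y assume "y \<in> sphere 0 1" "dist y x < d"
      then have "norm (support_functional y - support_functional x) \<le> e / 2"
        using x by (intro d[of y x])
          (auto simp: dist_norm norm_support_functional support_functional_self)
      then show "dist (support_functional y) (support_functional x) < e"
        using e by (simp add: dist_norm)
    qed
  qed
  then have "continuous_on (- {0}) (\<lambda>x::'x. support_functional (x /\<^sub>R norm x))"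
    by (rule continuous_on_compose2) (auto intro!: continuous_intros simp: field_simps split: if_splits)
  then show ?thesis
  proof (rule continuous_on_eq)
    fix x :: 'x assume "x \<in> - {0}"
    then show "support_functional (x /\<^sub>R norm x) = support_functional x"
      by (intro sc[symmetric]) simp
  qed
qed

end

section \<open>The duality mapping of a Bochner space on functions\<close>

text \<open>The duality mapping of \<open>X\<close> with gauge \<open>t\<^sup>r\<^sup>-\<^sup>1\<close>, that is, the gradient of \<open>\<parallel>x\<parallel>\<^sup>r / r\<close>. For
\<open>r > 1\<close> the factor tends to 0 at the origin, where support functionals are neither unique nor
continuous, so that the product is continuous everywhere.\<close>

definition power_duality :: "real \<Rightarrow> 'x::real_normed_vector \<Rightarrow> ('x \<Rightarrow>\<^sub>L real)" where
  "power_duality r x = (norm x powr (r - 1)) *\<^sub>R support_functional x"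

text \<open>If equality holds at \<open>a\<close>, then Young's inequality says that \<open>x \<mapsto> x\<^sup>p / p - x b\<close> is minimal at \<open>a\<close>, so
its derivative \<open>a\<^sup>p\<^sup>-\<^sup>1 - b\<close> vanishes there.\<close>

lemma Young_equality:
  fixes a b :: real
  assumes p: "1 < p" and q: "1 < q" and pq: "1 / p + 1 / q = 1" and ab: "0 \<le> a" "0 \<le> b"
    and eq: "a * b = a powr p / p + b powr q / q"
  shows "b = a powr (p - 1)"
proof (cases "a = 0")
  case True
  then show ?thesis using eq q by simp
next
  case False
  then have a: "0 < a" using ab by simp
  define f where "f x = x powr p / p - x * b" for x
  have "(f has_real_derivative a powr (p - 1) - b) (at a)"
    unfolding f_def using a p by (auto intro!: derivative_eq_intros)
  moreover have "\<forall>x. \<bar>a - x\<bar> < a \<longrightarrow> f a \<le> f x"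
  proof (intro allI impI)
    fix x assume "\<bar>a - x\<bar> < a"
    then have "0 \<le> x" by linarith
    from Youngs_inequality[OF p q pq this ab(2)] eq show "f a \<le> f x"
      by (simp add: f_def)
  qed
  ultimately have "a powr (p - 1) - b = 0"
    using a DERIV_local_min by blast
  then show ?thesis by simp
qed

locale smooth_conjugate_exponents = conjugate_exponents M p q
  for M :: "'s measure" and p q :: real +
  fixes X :: "'x::real_normed_vector itself"
  assumes smooth: "uniformly_smooth TYPE('x)"
begin

lemma norm_power_duality: "norm (power_duality p (x::'x)) = norm x powr (p - 1)"
  by (cases "x = 0") (auto simp: power_duality_def norm_support_functional_eq[OF smooth])

lemma power_duality_self: "power_duality p (x::'x) x = norm x powr p"
  by (cases "x = 0")
     (auto simp: power_duality_def scaleR_blinfun.rep_eq support_functional_self[OF smooth]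
       powr_mult_base mult.commute)

lemma continuous_on_power_duality: "continuous_on UNIV (power_duality p :: 'x \<Rightarrow> _)"
proof -
  have "continuous_on (- {0}) (power_duality p :: 'x \<Rightarrow> _)"
    unfolding power_duality_def
    by (intro continuous_intros continuous_on_support_functional[OF smooth]) auto
  then have 1: "isCont (power_duality p) x" if "x \<noteq> 0" for x :: 'x
    using that by (simp add: continuous_on_eq_continuous_at open_Compl)
  have 2: "isCont (power_duality p) (0::'x)"
  proof -
    have "((\<lambda>x::'x. norm x powr (p - 1)) \<longlongrightarrow> 0 powr (p - 1)) (at 0)"
      using p by (intro tendsto_intros tendsto_norm_zero) auto
    then have "((\<lambda>x::'x. norm (power_duality p x)) \<longlongrightarrow> 0) (at 0)"
      by (simp add: norm_power_duality)
    then have "(power_duality p \<longlongrightarrow> (0 :: 'x \<Rightarrow>\<^sub>L real)) (at 0)"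
      by (rule tendsto_norm_zero_cancel)
    then show ?thesis by (simp add: isCont_def power_duality_def)
  qed
  from 1 2 show ?thesis
    by (metis continuous_at_imp_continuous_on)
qed

lemma power_duality_Lp_fun:
  assumes h: "(h :: 's \<Rightarrow> 'x) \<in> Lp_fun M p"
  shows "(\<lambda>s. power_duality p (h s)) \<in> Lp_fun M q"
proof -
  have "strongly_measurable M (\<lambda>s. power_duality p (h s))"
    by (rule strongly_measurable_compose[OF _ continuous_on_power_duality])
       (use h in \<open>auto simp: Lp_fun_def power_duality_def\<close>)
  then show ?thesis
    using h by (simp add: Lp_fun_def norm_power_duality powr_powr conj_mult)
qed

lemma Lp_seminorm_power_duality:
  "Lp_seminorm M q (\<lambda>s. power_duality p (h s :: 'x)) = Lp_seminorm M p h powr (p - 1)"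
  using powr_conj_seminorm[of "\<lambda>s. norm (h s)"]
  by (simp add: Lp_seminorm_def norm_power_duality)

lemma integrable_pairing:
  assumes f: "(\<phi> :: 's \<Rightarrow> 'x \<Rightarrow>\<^sub>L real) \<in> Lp_fun M q" and k: "k \<in> Lp_fun M p"
  shows "integrable M (\<lambda>s. \<phi> s (k s))"
proof (rule Bochner_Integration.integrable_bound)
  interpret swap: conjugate_exponents M q p by (rule conjugate_exponents_swap)
  show "integrable M (\<lambda>s. norm (k s) * norm (\<phi> s))"
    using f k by (intro Hoelder_integrable Lp_fun_measurable[of k p] Lp_fun_measurable[of \<phi> q])
      (auto simp: Lp_fun_def)
  show "(\<lambda>s. \<phi> s (k s)) \<in> borel_measurable M"
    by (rule borel_measurable_strongly_measurable, rule strongly_measurable_compose2[of M \<phi> k])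
       (use f k in \<open>auto simp: Lp_fun_def intro!: continuous_intros\<close>)
  show "AE s in M. norm (\<phi> s (k s)) \<le> norm (norm (k s) * norm (\<phi> s))"
    using norm_blinfun[of "\<phi> _" "k _"] by (simp add: mult.commute)
qed

lemma pairing_le:
  assumes f: "(\<phi> :: 's \<Rightarrow> 'x \<Rightarrow>\<^sub>L real) \<in> Lp_fun M q" and k: "k \<in> Lp_fun M p"
  shows "(\<integral>s. \<phi> s (k s) \<partial>M) \<le> Lp_seminorm M q \<phi> * Lp_seminorm M p k"
proof -
  have "(\<integral>s. \<phi> s (k s) \<partial>M) \<le> (\<integral>s. norm (k s) * norm (\<phi> s) \<partial>M)"
  proof (rule integral_mono[OF integrable_pairing[OF f k]])
    show "integrable M (\<lambda>s. norm (k s) * norm (\<phi> s))"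
      using f k by (intro Hoelder_integrable Lp_fun_measurable[of k p] Lp_fun_measurable[of \<phi> q])
        (auto simp: Lp_fun_def)
    show "\<phi> s (k s) \<le> norm (k s) * norm (\<phi> s)" for s
      using norm_blinfun[of "\<phi> s" "k s"] by (simp add: mult.commute)
  qed
  also have "\<dots> \<le> Lp_seminorm M p (\<lambda>s. norm (k s)) * Lp_seminorm M q (\<lambda>s. norm (\<phi> s))"
    using f k by (intro Hoelder_integral Lp_fun_measurable[of k p] Lp_fun_measurable[of \<phi> q])
      (auto simp: Lp_fun_def)
  finally show ?thesis
    by (simp add: Lp_seminorm_def mult.commute)
qed

lemma pairing_power_duality_self:
  "(\<integral>s. power_duality p (h s :: 'x) (h s) \<partial>M) = Lp_seminorm M p h powr p"
  by (simp add: power_duality_self Lp_seminorm_powr)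

text \<open>One half of the norm characterization: \<open>h\<close> attains Hoelder's inequality against its own dual,
and passing from \<open>h\<close> to \<open>h - t k\<close> does not decrease the pairing with that dual.\<close>

lemma seminorm_le_if_pairing_nonpos:
  assumes h: "(h :: 's \<Rightarrow> 'x) \<in> Lp_fun M p" and k: "k \<in> Lp_fun M p"
    and le: "(\<integral>s. power_duality p (h s) (k s) \<partial>M) \<le> 0" and t: "0 \<le> t"
  shows "Lp_seminorm M p h \<le> Lp_seminorm M p (\<lambda>s. h s - t *\<^sub>R k s)"
proof -
  define N where "N = Lp_seminorm M p h"
  note d = power_duality_Lp_fun[OF h]
  note hk = Lp_fun_diff[OF h Lp_fun_scale[OF k, of t]]
  have "N powr (p - 1) * N = N powr p"
    by (cases "N = 0") (auto simp: powr_mult_base mult.commute N_def Lp_seminorm_nonneg)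
  also have "\<dots> \<le> N powr p - t * (\<integral>s. power_duality p (h s) (k s) \<partial>M)"
    using le t by (simp add: mult_nonneg_nonpos)
  also have "\<dots> = (\<integral>s. power_duality p (h s) (h s - t *\<^sub>R k s) \<partial>M)"
    using integrable_pairing[OF d h] integrable_pairing[OF d k]
    by (simp add: blinfun.bilinear_simps pairing_power_duality_self N_def)
  also have "\<dots> \<le> N powr (p - 1) * Lp_seminorm M p (\<lambda>s. h s - t *\<^sub>R k s)"
    using pairing_le[OF d hk] by (simp add: Lp_seminorm_power_duality N_def)
  finally show ?thesis
    by (cases "N = 0") (auto simp: N_def Lp_seminorm_nonneg)
qed

text \<open>The converse half is differentiation of the norm at \<open>h\<close>. For \<open>u = h - t k\<close> with \<open>t > 0\<close>, the
pairing of the dual of \<open>u\<close> with \<open>h\<close> is at most \<open>\<parallel>u\<parallel>\<^sup>p\<^sup>-\<^sup>1 \<parallel>h\<parallel> \<le> \<parallel>u\<parallel>\<^sup>p\<close>, which is its pairing with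
\<open>u\<close> itself; hence its pairing with \<open>k\<close> is nonpositive. Let \<open>t\<close> tend to 0 and use dominated
convergence, with the continuity of the duality mapping of \<open>X\<close>.\<close>

lemma pairing_nonpos_if_seminorm_le:
  assumes h: "(h :: 's \<Rightarrow> 'x) \<in> Lp_fun M p" and k: "k \<in> Lp_fun M p"
    and le: "\<And>t. 0 \<le> t \<Longrightarrow> Lp_seminorm M p h \<le> Lp_seminorm M p (\<lambda>s. h s - t *\<^sub>R k s)"
  shows "(\<integral>s. power_duality p (h s) (k s) \<partial>M) \<le> 0"
proof -
  define t where "t n = 1 / real (Suc n)" for n
  have t: "0 < t n" "t n \<le> 1" for n by (auto simp: t_def)
  have t0: "t \<longlonglongrightarrow> 0" 
    unfolding t_def using LIMSEQ_inverse_real_of_nat by (simp add: inverse_eq_divide)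
  define u where "u n s = h s - t n *\<^sub>R k s" for n s
  have u: "u n \<in> Lp_fun M p" for n
    unfolding u_def by (intro Lp_fun_diff h Lp_fun_scale k)
  have d: "(\<lambda>s. power_duality p (u n s)) \<in> Lp_fun M q" for n
    by (rule power_duality_Lp_fun[OF u])
  have nonpos: "(\<integral>s. power_duality p (u n s) (k s) \<partial>M) \<le> 0" for n
  proof -
    define N where "N = Lp_seminorm M p (u n)"
    have "(\<integral>s. power_duality p (u n s) (h s) \<partial>M) \<le> N powr (p - 1) * Lp_seminorm M p h"
      using pairing_le[OF d h] by (simp add: Lp_seminorm_power_duality N_def)
    also have "\<dots> \<le> N powr (p - 1) * N"
      using le[of "t n"] t(1)[of n] by (intro mult_left_mono) (auto simp: N_def u_def[abs_def])
    also have "\<dots> = N powr p"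
      by (cases "N = 0") (auto simp: powr_mult_base mult.commute N_def Lp_seminorm_nonneg)
    also have "\<dots> = (\<integral>s. power_duality p (u n s) (u n s) \<partial>M)"
      by (simp add: pairing_power_duality_self N_def)
    also have "\<dots> = (\<integral>s. power_duality p (u n s) (h s) - t n * power_duality p (u n s) (k s) \<partial>M)"
      by (rule Bochner_Integration.integral_cong)
         (auto simp: u_def blinfun.bilinear_simps)
    also have "\<dots> = (\<integral>s. power_duality p (u n s) (h s) \<partial>M) - t n * (\<integral>s. power_duality p (u n s) (k s) \<partial>M)"
      using integrable_pairing[OF d h] integrable_pairing[OF d k] by simp
    finally show ?thesis
      using t(1)[of n] by (simp add: mult_le_0_iff)
  qed
  have "(\<lambda>n. \<integral>s. power_duality p (u n s) (k s) \<partial>M) \<longlonglongrightarrow> (\<integral>s. power_duality p (h s) (k s) \<partial>M)"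
  proof (rule integral_dominated_convergence)
    let ?w = "\<lambda>s. 2 powr p * (norm (h s) powr p + norm (k s) powr p)"
    show "integrable M ?w"
      using h k by (auto simp: Lp_fun_def)
    show "(\<lambda>s. power_duality p (h s) (k s)) \<in> borel_measurable M"
      using integrable_pairing[OF power_duality_Lp_fun[OF h] k] by auto
    show "(\<lambda>s. power_duality p (u n s) (k s)) \<in> borel_measurable M" for n
      using integrable_pairing[OF d k] by auto
    show "AE s in M. (\<lambda>n. power_duality p (u n s) (k s)) \<longlonglongrightarrow> power_duality p (h s) (k s)"
    proof (rule AE_I2)
      fix s
      have "(\<lambda>n. h s - t n *\<^sub>R k s) \<longlonglongrightarrow> h s - 0 *\<^sub>R k s"
        by (intro tendsto_intros t0)
      then have "(\<lambda>n. u n s) \<longlonglongrightarrow> h s" by (simp add: u_def)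
      moreover have "isCont (power_duality p) (h s)"
        using continuous_on_power_duality by (simp add: continuous_on_eq_continuous_at)
      ultimately show "(\<lambda>n. power_duality p (u n s) (k s)) \<longlonglongrightarrow> power_duality p (h s) (k s)"
        by (intro tendsto_intros isCont_tendsto_compose[of "h s" "power_duality p"])
    qed
    show "AE s in M. norm (power_duality p (u n s) (k s)) \<le> ?w s" for n
    proof (rule AE_I2)
      fix s
      define c where "c = norm (h s) + norm (k s)"
      have "norm (u n s) \<le> norm (h s) + norm (t n *\<^sub>R k s)"
        unfolding u_def by (rule norm_triangle_ineq4)
      also have "\<dots> \<le> c"
        using t[of n] by (auto simp: c_def mult_left_le_one_le)
      finally have uc: "norm (u n s) \<le> c" .
      have "norm (power_duality p (u n s) (k s)) \<le> norm (power_duality p (u n s)) * norm (k s)"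
        by (rule norm_blinfun)
      also have "\<dots> \<le> c powr (p - 1) * c"
        unfolding norm_power_duality using p uc
        by (intro mult_mono powr_mono2) (auto simp: c_def)
      also have "\<dots> = c powr p"
        by (cases "c = 0") (auto simp: powr_mult_base mult.commute c_def)
      also have "\<dots> \<le> ?w s"
        unfolding c_def by (rule powr_sum_le) auto
      finally show "norm (power_duality p (u n s) (k s)) \<le> ?w s" .
    qed
  qed
  then show ?thesis
    by (rule LIMSEQ_le_const2) (use nonpos in auto)
qed

text \<open>The factor \<open>\<parallel>h\<parallel>\<^sup>2\<^sup>-\<^sup>p\<close> normalizes the \<open>L\<^sub>q\<close> norm from \<open>\<parallel>h\<parallel>\<^sup>p\<^sup>-\<^sup>1\<close> to \<open>\<parallel>h\<parallel>\<close>.\<close>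

definition Lp_dual :: "('s \<Rightarrow> 'x) \<Rightarrow> 's \<Rightarrow> ('x \<Rightarrow>\<^sub>L real)" where
  "Lp_dual h s = (Lp_seminorm M p h powr (2 - p)) *\<^sub>R power_duality p (h s)"

lemma Lp_dual_Lp_fun: "h \<in> Lp_fun M p \<Longrightarrow> Lp_dual h \<in> Lp_fun M q"
proof -
  interpret swap: conjugate_exponents M q p by (rule conjugate_exponents_swap)
  show "Lp_dual h \<in> Lp_fun M q" if "h \<in> Lp_fun M p"
    unfolding Lp_dual_def by (intro swap.Lp_fun_scale power_duality_Lp_fun that)
qed

lemma Lp_seminorm_Lp_dual: "Lp_seminorm M q (Lp_dual h) = Lp_seminorm M p h"
proof -
  interpret swap: conjugate_exponents M q p by (rule conjugate_exponents_swap)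
  have "Lp_seminorm M q (Lp_dual h)
      = Lp_seminorm M p h powr (2 - p) * Lp_seminorm M p h powr (p - 1)"
    unfolding Lp_dual_def swap.Lp_seminorm_scale Lp_seminorm_power_duality by simp
  also have "\<dots> = Lp_seminorm M p h"
    using Lp_seminorm_nonneg[of M p h] by (simp flip: powr_add)
  finally show ?thesis .
qed

lemma pairing_Lp_dual_self: "(\<integral>s. Lp_dual h s (h s) \<partial>M) = (Lp_seminorm M p h)\<^sup>2"
proof -
  have "(\<integral>s. Lp_dual h s (h s) \<partial>M) = Lp_seminorm M p h powr (2 - p) * Lp_seminorm M p h powr p"
    by (simp add: Lp_dual_def scaleR_blinfun.rep_eq pairing_power_duality_self)
  also have "\<dots> = (Lp_seminorm M p h)\<^sup>2"
    using Lp_seminorm_nonneg[of M p h] by (simp flip: powr_add)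
  finally show ?thesis .
qed

text \<open>The hypotheses say that Hoelder's inequality is an equality. Hence the integrated Young inequality
is one too, and it holds pointwise almost everywhere: this determines \<open>\<parallel>\<phi> s\<parallel>\<close> by the
equality case, and shows that \<open>\<phi> s\<close> attains its norm at \<open>h s\<close>, which by smoothness determines its
direction.\<close>

lemma Lp_dual_unique:
  fixes \<phi> :: "'s \<Rightarrow> 'x \<Rightarrow>\<^sub>L real"
  assumes h: "h \<in> Lp_fun M p" and f: "\<phi> \<in> Lp_fun M q"
    and norm: "Lp_seminorm M q \<phi> = Lp_seminorm M p h"
    and pair: "(\<integral>s. \<phi> s (h s) \<partial>M) = (Lp_seminorm M p h)\<^sup>2"
  shows "AE s in M. \<phi> s = Lp_dual h s"
proof -
  interpret swap: conjugate_exponents M q p by (rule conjugate_exponents_swap)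
  define N where "N = Lp_seminorm M p h"
  have N0: "0 \<le> N" by (simp add: N_def Lp_seminorm_nonneg)
  show ?thesis
  proof (cases "N = 0")
    case True
    then have "AE s in M. h s = 0" "AE s in M. \<phi> s = 0"
      using Lp_seminorm_eq_0_iff[OF h] swap.Lp_seminorm_eq_0_iff[OF f] norm by (auto simp: N_def)
    then show ?thesis
      by eventually_elim (auto simp: Lp_dual_def power_duality_def)
  next
    case False
    then have N: "0 < N" using N0 by simp
    \<comment> \<open>The pointwise deficit in Young's and the pairing inequality, which integrates to 0.\<close>
    define D where "D s = (norm (h s) / N) powr p / p + (norm (\<phi> s) / N) powr q / q - \<phi> s (h s) / N\<^sup>2"
      for s
    have b: "\<phi> s (h s) / N\<^sup>2 \<le> (norm (h s) / N) * (norm (\<phi> s) / N)" for s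
      using norm_blinfun[of "\<phi> s" "h s"] N
      by (auto simp: power2_eq_square divide_simps mult.commute)
    have Y: "(norm (h s) / N) * (norm (\<phi> s) / N) \<le>
        (norm (h s) / N) powr p / p + (norm (\<phi> s) / N) powr q / q" for s
      using N by (intro Youngs_inequality p q pq) auto
    have D0: "0 \<le> D s" for s
      using b[of s] Y[of s] by (simp add: D_def)
    have ints: "integrable M (\<lambda>s. norm (h s) powr p)" "integrable M (\<lambda>s. norm (\<phi> s) powr q)"
      "integrable M (\<lambda>s. \<phi> s (h s))"
      using h f integrable_pairing[OF f h] by (auto simp: Lp_fun_def)
    have D_eq: "D = (\<lambda>s. (norm (h s) powr p / N powr p) / p + (norm (\<phi> s) powr q / N powr q) / q
        - \<phi> s (h s) / N\<^sup>2)"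
      using N by (auto simp: D_def powr_divide)
    have "integrable M D"
      unfolding D_eq using ints by auto
    moreover have "(\<integral>s. D s \<partial>M) = 0"
    proof -
      have "(\<integral>s. D s \<partial>M) = (\<integral>s. norm (h s) powr p \<partial>M) / N powr p / p
          + (\<integral>s. norm (\<phi> s) powr q \<partial>M) / N powr q / q - (\<integral>s. \<phi> s (h s) \<partial>M) / N\<^sup>2"
        unfolding D_eq using ints by simp
      also have "\<dots> = N powr p / N powr p / p + N powr q / N powr q / q - N\<^sup>2 / N\<^sup>2"
        using Lp_seminorm_powr[of h] swap.Lp_seminorm_powr[of \<phi>] norm pair
        by (simp add: N_def)
      also have "\<dots> = 0"
        using N pq by simp
      finally show ?thesis .
    qed
    ultimately have "AE s in M. D s = 0"
      using integral_nonneg_eq_0_iff_AE[of M D] D0 by auto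
    then show ?thesis
    proof eventually_elim
      case (elim s)
      have eq: "(norm (h s) / N) * (norm (\<phi> s) / N) =
          (norm (h s) / N) powr p / p + (norm (\<phi> s) / N) powr q / q"
        using elim b[of s] Y[of s] by (simp add: D_def)
      have "norm (\<phi> s) / N = (norm (h s) / N) powr (p - 1)"
        by (rule Young_equality[OF p q pq _ _ eq]) (use N in auto)
      also have "\<dots> = norm (h s) powr (p - 1) / N powr (p - 1)"
        using N by (simp add: powr_divide)
      finally have "norm (\<phi> s) = N * N powr (- (p - 1)) * norm (h s) powr (p - 1)"
        using N by (simp only: powr_minus_divide) (simp add: field_simps)
      also have "N * N powr (- (p - 1)) = N powr (2 - p)"
        using N by (simp add: powr_mult_base)
      finally have n: "norm (\<phi> s) = N powr (2 - p) * norm (h s) powr (p - 1)" .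
      have "\<phi> s (h s) / N\<^sup>2 = (norm (h s) / N) * (norm (\<phi> s) / N)"
        using elim eq by (simp add: D_def)
      then have pp: "\<phi> s (h s) = norm (\<phi> s) * norm (h s)"
        using N by (simp add: power2_eq_square)
      show "\<phi> s = Lp_dual h s"
      proof (cases "h s = 0")
        case True
        then show ?thesis using n by (simp add: Lp_dual_def power_duality_def)
      next
        case False
        then have n0: "norm (\<phi> s) \<noteq> 0" using n N by simp
        have "\<phi> s /\<^sub>R norm (\<phi> s) = support_functional (h s)"
          by (rule support_functional_unique[OF smooth False])
             (use n0 pp in \<open>auto simp: scaleR_blinfun.rep_eq\<close>)
        then have "\<phi> s = norm (\<phi> s) *\<^sub>R support_functional (h s)"
          using n0 by (metis scaleR_one scaleR_scaleR right_inverse)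
        then show ?thesis
          using n by (simp add: Lp_dual_def power_duality_def N_def)
      qed
    qed
  qed
qed

text \<open>The hinge of the whole proof: the sign condition on the (nonlinear) duality mapping becomes a family
of inequalities between norms, a one-sided form of Birkhoff-James orthogonality.\<close>

lemma pairing_Lp_dual_nonpos_iff:
  assumes h: "h \<in> Lp_fun M p" and k: "k \<in> Lp_fun M p"
  shows "(\<integral>s. Lp_dual h s (k s) \<partial>M) \<le> 0 \<longleftrightarrow>
    (\<forall>t\<ge>0. Lp_seminorm M p h \<le> Lp_seminorm M p (\<lambda>s. h s - t *\<^sub>R k s))"
proof -
  have eq: "(\<integral>s. Lp_dual h s (k s) \<partial>M) =
      Lp_seminorm M p h powr (2 - p) * (\<integral>s. power_duality p (h s) (k s) \<partial>M)"
    by (simp add: Lp_dual_def scaleR_blinfun.rep_eq)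
  show ?thesis
  proof (cases "Lp_seminorm M p h = 0")
    case True
    then show ?thesis by (simp add: eq Lp_seminorm_nonneg)
  next
    case False
    then have "(\<integral>s. Lp_dual h s (k s) \<partial>M) \<le> 0 \<longleftrightarrow> (\<integral>s. power_duality p (h s) (k s) \<partial>M) \<le> 0"
      by (simp add: eq mult_le_0_iff)
    then show ?thesis
      using seminorm_le_if_pairing_nonpos[OF h k] pairing_nonpos_if_seminorm_le[OF h k] by blast
  qed
qed

end

section \<open>Bochner spaces as metric spaces of classes\<close>

lemma Lp_norm_eq: "Lp_norm M p F = Lp_seminorm M p (Lp_rep F)"
  by (simp add: Lp_norm_def Lp_seminorm_def)

lemma equiv_Lp_rel: "equiv (Lp_fun M p) (Lp_rel M p)"
proof (rule equivI)
  show "Lp_rel M p \<subseteq> Lp_fun M p \<times> Lp_fun M p"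
    by (auto simp: Lp_rel_def)
  show "refl_on (Lp_fun M p) (Lp_rel M p)"
    by (auto simp: refl_on_def Lp_rel_def)
  show "sym (Lp_rel M p)"
    by (auto simp: sym_def Lp_rel_def elim: eventually_mono)
  show "trans (Lp_rel M p)"
    unfolding trans_def Lp_rel_def by (auto elim: eventually_elim2)
qed

lemma Lp_class_in_Lp: "f \<in> Lp_fun M p \<Longrightarrow> Lp_class M p f \<in> Lp M p"
  unfolding Lp_class_def Lp_def by (rule quotientI)

lemma Lp_class_eq_iff:
  "f \<in> Lp_fun M p \<Longrightarrow> g \<in> Lp_fun M p \<Longrightarrow> Lp_class M p f = Lp_class M p g \<longleftrightarrow> (AE s in M. f s = g s)"
  unfolding Lp_class_def by (subst eq_equiv_class_iff[OF equiv_Lp_rel]) (auto simp: Lp_rel_def)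

lemma Lp_rep_class:
  assumes f: "f \<in> Lp_fun M p"
  shows "Lp_rep (Lp_class M p f) \<in> Lp_fun M p" "AE s in M. Lp_rep (Lp_class M p f) s = f s"
proof -
  have "f \<in> Lp_class M p f"
    using f by (simp add: Lp_class_def Lp_rel_def)
  then have "Lp_rep (Lp_class M p f) \<in> Lp_class M p f"
    unfolding Lp_rep_def by (rule someI[where P = "\<lambda>g. g \<in> Lp_class M p f"])
  then show "Lp_rep (Lp_class M p f) \<in> Lp_fun M p" "AE s in M. Lp_rep (Lp_class M p f) s = f s"
    by (auto simp: Lp_class_def Lp_rel_def elim: eventually_mono)
qed

lemma Lp_rep_in_Lp_fun: "F \<in> Lp M p \<Longrightarrow> Lp_rep F \<in> Lp_fun M p"
  unfolding Lp_def using Lp_rep_class(1) by (auto elim!: quotientE simp flip: Lp_class_def)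

lemma Lp_class_rep: "F \<in> Lp M p \<Longrightarrow> Lp_class M p (Lp_rep F) = F"
  unfolding Lp_def
  by (elim quotientE, fold Lp_class_def) (simp add: Lp_class_eq_iff Lp_rep_class)

context conjugate_exponents
begin

lemma Lp_norm_class: "f \<in> Lp_fun M p \<Longrightarrow> Lp_norm M p (Lp_class M p f) = Lp_seminorm M p f"
  unfolding Lp_norm_eq by (rule Lp_seminorm_cong_AE) (auto simp: Lp_rep_class)

lemma Lp_plus_class:
  assumes f: "f \<in> Lp_fun M p" and g: "g \<in> Lp_fun M p"
  shows "Lp_plus M p (Lp_class M p f) (Lp_class M p g) = Lp_class M p (\<lambda>s. f s + g s)"
  unfolding Lp_plus_def
  by (subst Lp_class_eq_iff, intro Lp_fun_add Lp_rep_class f g, intro Lp_fun_add f g)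
     (use Lp_rep_class(2)[OF f] Lp_rep_class(2)[OF g] in eventually_elim, simp)

lemma Lp_minus_class:
  assumes f: "f \<in> Lp_fun M p" and g: "g \<in> Lp_fun M p"
  shows "Lp_minus M p (Lp_class M p f) (Lp_class M p g) = Lp_class M p (\<lambda>s. f s - g s)"
  unfolding Lp_minus_def
  by (subst Lp_class_eq_iff, intro Lp_fun_diff Lp_rep_class f g, intro Lp_fun_diff f g)
     (use Lp_rep_class(2)[OF f] Lp_rep_class(2)[OF g] in eventually_elim, simp)

lemma Lp_scale_class:
  assumes f: "f \<in> Lp_fun M p"
  shows "Lp_scale M p c (Lp_class M p f) = Lp_class M p (\<lambda>s. c *\<^sub>R f s)"
  unfolding Lp_scale_def
  by (subst Lp_class_eq_iff, intro Lp_fun_scale Lp_rep_class f, intro Lp_fun_scale f)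
     (use Lp_rep_class(2)[OF f] in eventually_elim, simp)

lemma Lp_zero_in_Lp: "Lp_zero M p \<in> Lp M p"
  unfolding Lp_zero_def by (rule Lp_class_in_Lp[OF Lp_fun_0])

lemma Lp_rep_zero: "AE s in M. Lp_rep (Lp_zero M p) s = 0"
  unfolding Lp_zero_def by (rule Lp_rep_class(2)[OF Lp_fun_0])

lemma Lp_dist_eq:
  assumes F: "F \<in> Lp M p" and G: "G \<in> Lp M p"
  shows "Lp_dist M p F G = Lp_seminorm M p (\<lambda>s. Lp_rep F s - Lp_rep G s)"
  unfolding Lp_dist_def Lp_minus_def
  by (rule Lp_norm_class) (intro Lp_fun_diff Lp_rep_in_Lp_fun F G)

text \<open>Symmetry is required of the distance even for arguments outside of the space.\<close>

lemma Metric_space_Lp: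
  "Metric_space (Lp M p :: ('s \<Rightarrow> 'x::real_normed_vector) set set) (Lp_dist M p)"
proof
  show "0 \<le> Lp_dist M p F G" for F G :: "('s \<Rightarrow> 'x) set"
    by (simp add: Lp_dist_def Lp_norm_def)
  show "Lp_dist M p F G = Lp_dist M p G F" for F G :: "('s \<Rightarrow> 'x) set"
  proof -
    let ?d = "\<lambda>s. Lp_rep F s - Lp_rep G s" and ?e = "\<lambda>s. Lp_rep G s - Lp_rep F s"
    show ?thesis
    proof (cases "?d \<in> Lp_fun M p")
      case True
      then have "?e \<in> Lp_fun M p"
        using Lp_fun_scale[OF True, of "-1"] by simp
      with True show ?thesis
        by (simp add: Lp_dist_def Lp_minus_def Lp_norm_class Lp_seminorm_def norm_minus_commute)
    next
      \<comment> \<open>A function outside of the space has the empty set as its class.\<close>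
      case False
      then have "?e \<notin> Lp_fun M p"
        using Lp_fun_scale[of ?e "-1"] by auto
      with False have "Lp_minus M p F G = {}" "Lp_minus M p G F = {}"
        by (auto simp: Lp_minus_def Lp_class_def Lp_rel_def)
      then show ?thesis by (simp add: Lp_dist_def)
    qed
  qed
  fix F G :: "('s \<Rightarrow> 'x) set" assume F: "F \<in> Lp M p" and G: "G \<in> Lp M p"
  note rep = Lp_rep_in_Lp_fun[OF F] Lp_rep_in_Lp_fun[OF G]
  show "Lp_dist M p F G = 0 \<longleftrightarrow> F = G"
    using Lp_class_eq_iff[OF rep]
    by (simp add: Lp_dist_eq F G Lp_seminorm_eq_0_iff Lp_fun_diff rep Lp_class_rep)
  fix H :: "('s \<Rightarrow> 'x) set" assume H: "H \<in> Lp M p"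
  show "Lp_dist M p F H \<le> Lp_dist M p F G + Lp_dist M p G H"
    using Lp_seminorm_triangle[OF Lp_fun_diff[OF rep] Lp_fun_diff[OF rep(2) Lp_rep_in_Lp_fun[OF H]]]
    by (simp add: Lp_dist_eq F G H)
qed

end

section \<open>Inverse support sets described by norm inequalities\<close>

context smooth_conjugate_exponents
begin

lemma duality_map_eq:
  assumes F: "(F :: ('s \<Rightarrow> 'x) set) \<in> Lp M p"
  shows "duality_map M p q F = Lp_class M q (Lp_dual (Lp_rep F))"
proof -
  interpret swap: conjugate_exponents M q p by (rule conjugate_exponents_swap)
  let ?h = "Lp_rep F"
  note h = Lp_rep_in_Lp_fun[OF F]
  note d = Lp_dual_Lp_fun[OF h]
  show ?thesis
    unfolding duality_map_def
  proof (rule the_equality, intro conjI)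
    show "Lp_class M q (Lp_dual ?h) \<in> Lp M q"
      by (rule Lp_class_in_Lp[OF d])
    have n: "Lp_norm M q (Lp_class M q (Lp_dual ?h)) = Lp_norm M p F"
      by (simp add: swap.Lp_norm_class d Lp_seminorm_Lp_dual Lp_norm_eq[of M p F])
    then show "Lp_norm M q (Lp_class M q (Lp_dual ?h)) * Lp_norm M p F = (Lp_norm M p F)\<^sup>2"
      "(Lp_norm M p F)\<^sup>2 = (Lp_norm M q (Lp_class M q (Lp_dual ?h)))\<^sup>2"
      by (simp_all add: power2_eq_square)
    have "Lp_pairing M (Lp_class M q (Lp_dual ?h)) F = (\<integral>s. Lp_dual ?h s (?h s) \<partial>M)"
      unfolding Lp_pairing_def
    proof (rule integral_cong_AE)
      show "AE s in M. Lp_rep (Lp_class M q (Lp_dual ?h)) s (?h s) = Lp_dual ?h s (?h s)"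
        using Lp_rep_class(2)[OF d] by eventually_elim simp
    qed (use integrable_pairing[OF Lp_rep_class(1)[OF d] h] integrable_pairing[OF d h] in auto)
    with n show "Lp_pairing M (Lp_class M q (Lp_dual ?h)) F
        = Lp_norm M q (Lp_class M q (Lp_dual ?h)) * Lp_norm M p F"
      by (simp add: pairing_Lp_dual_self Lp_norm_eq[of M p F] power2_eq_square)
  next
    fix \<Phi> assume *: "\<Phi> \<in> Lp M q \<and> Lp_pairing M \<Phi> F = Lp_norm M q \<Phi> * Lp_norm M p F \<and>
      Lp_norm M q \<Phi> * Lp_norm M p F = (Lp_norm M p F)\<^sup>2 \<and> (Lp_norm M p F)\<^sup>2 = (Lp_norm M q \<Phi>)\<^sup>2"
    then have \<Phi>: "\<Phi> \<in> Lp M q" by blast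
    have "Lp_norm M q \<Phi> = Lp_norm M p F"
      using * by (auto simp: Lp_norm_def)
    with * have "AE s in M. Lp_rep \<Phi> s = Lp_dual ?h s"
      by (intro Lp_dual_unique h Lp_rep_in_Lp_fun) (auto simp: Lp_norm_eq Lp_pairing_def)
    then have "Lp_class M q (Lp_rep \<Phi>) = Lp_class M q (Lp_dual ?h)"
      by (simp add: Lp_class_eq_iff Lp_rep_in_Lp_fun[OF \<Phi>] d)
    then show "\<Phi> = Lp_class M q (Lp_dual ?h)"
      by (simp add: Lp_class_rep \<Phi>)
  qed
qed

lemma Lp_pairing_duality_map:
  assumes H: "(H :: ('s \<Rightarrow> 'x) set) \<in> Lp M p" and F: "F \<in> Lp M p"
  shows "Lp_pairing M (duality_map M p q H) F = (\<integral>s. Lp_dual (Lp_rep H) s (Lp_rep F s) \<partial>M)"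
  unfolding Lp_pairing_def duality_map_eq[OF H]
proof (rule integral_cong_AE)
  note d = Lp_dual_Lp_fun[OF Lp_rep_in_Lp_fun[OF H]]
  show "AE s in M. Lp_rep (Lp_class M q (Lp_dual (Lp_rep H))) s (Lp_rep F s)
      = Lp_dual (Lp_rep H) s (Lp_rep F s)"
    using Lp_rep_class(2)[OF d] by eventually_elim simp
qed (use integrable_pairing[OF Lp_rep_class(1)[OF Lp_dual_Lp_fun[OF Lp_rep_in_Lp_fun[OF H]]] Lp_rep_in_Lp_fun[OF F]]
    integrable_pairing[OF Lp_dual_Lp_fun[OF Lp_rep_in_Lp_fun[OF H]] Lp_rep_in_Lp_fun[OF F]] in auto)

text \<open>As \<open>G\<close> itself lies in \<open>C\<close>, the extended real supremum is attained at \<open>G\<close> iff the pairing with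
\<open>F - G\<close> is nonpositive for every \<open>F\<close> in \<open>C\<close>.\<close>

lemma inv_support_set_iff:
  assumes C: "C \<subseteq> (Lp M p :: ('s \<Rightarrow> 'x) set set)" and G: "G \<in> C"
  shows "H \<in> inv_support_set M p q C G \<longleftrightarrow> H \<in> Lp M p \<and>
    (\<forall>F\<in>C. \<forall>t\<ge>0. Lp_seminorm M p (Lp_rep H)
        \<le> Lp_seminorm M p (\<lambda>s. Lp_rep H s - t *\<^sub>R (Lp_rep F s - Lp_rep G s)))"
proof (cases "H \<in> Lp M p")
  case True
  let ?pair = "Lp_pairing M (duality_map M p q H)"
  have "ereal (?pair G) = (SUP F\<in>C. ereal (?pair F)) \<longleftrightarrow> (\<forall>F\<in>C. ?pair F \<le> ?pair G)"
  proof
    assume "ereal (?pair G) = (SUP F\<in>C. ereal (?pair F))"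
    then show "\<forall>F\<in>C. ?pair F \<le> ?pair G"
      by (metis SUP_upper ereal_less_eq(3))
  next
    assume "\<forall>F\<in>C. ?pair F \<le> ?pair G"
    then show "ereal (?pair G) = (SUP F\<in>C. ereal (?pair F))"
      by (intro antisym SUP_upper[OF G] SUP_least) auto
  qed
  also have "\<dots> \<longleftrightarrow> (\<forall>F\<in>C. \<forall>t\<ge>0. Lp_seminorm M p (Lp_rep H)
        \<le> Lp_seminorm M p (\<lambda>s. Lp_rep H s - t *\<^sub>R (Lp_rep F s - Lp_rep G s)))"
  proof (rule ball_cong[OF refl])
    fix F assume "F \<in> C"
    then have F: "F \<in> Lp M p" and G': "G \<in> Lp M p" using C G by auto
    note r = Lp_rep_in_Lp_fun[OF True] Lp_rep_in_Lp_fun[OF F] Lp_rep_in_Lp_fun[OF G']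
    have "?pair F - ?pair G = (\<integral>s. Lp_dual (Lp_rep H) s (Lp_rep F s - Lp_rep G s) \<partial>M)"
      using integrable_pairing[OF Lp_dual_Lp_fun[OF r(1)] r(2)]
        integrable_pairing[OF Lp_dual_Lp_fun[OF r(1)] r(3)]
      by (simp add: Lp_pairing_duality_map True F G' blinfun.diff_right)
    then have "?pair F \<le> ?pair G \<longleftrightarrow>
        (\<integral>s. Lp_dual (Lp_rep H) s (Lp_rep F s - Lp_rep G s) \<partial>M) \<le> 0"
      by linarith
    then show "?pair F \<le> ?pair G \<longleftrightarrow> (\<forall>t\<ge>0. Lp_seminorm M p (Lp_rep H)
        \<le> Lp_seminorm M p (\<lambda>s. Lp_rep H s - t *\<^sub>R (Lp_rep F s - Lp_rep G s)))"
      using pairing_Lp_dual_nonpos_iff[OF r(1) Lp_fun_diff[OF r(2,3)]] by simp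
  qed
  finally show ?thesis
    using True by (simp add: inv_support_set_def)
qed (simp add: inv_support_set_def)

lemma zero_in_inv_support_set:
  assumes C: "C \<subseteq> (Lp M p :: ('s \<Rightarrow> 'x) set set)" and G: "G \<in> C"
  shows "Lp_zero M p \<in> inv_support_set M p q C G"
proof -
  have "Lp_seminorm M p (Lp_rep (Lp_zero M p) :: 's \<Rightarrow> 'x) = 0"
    using Lp_seminorm_eq_0_iff[OF Lp_rep_in_Lp_fun[OF Lp_zero_in_Lp]] Lp_rep_zero by blast
  then show ?thesis
    by (simp add: inv_support_set_iff[OF C G] Lp_zero_in_Lp Lp_seminorm_nonneg)
qed

text \<open>Each of the norm inequalities is a closed condition on \<open>H\<close>: a strict violation persists on the
ball whose radius is half of the violation, as both sides are 1-Lipschitz in \<open>H\<close>.\<close>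

lemma closedin_inv_support_set:
  assumes C: "C \<subseteq> (Lp M p :: ('s \<Rightarrow> 'x) set set)" and G: "G \<in> C"
  shows "closedin (Lp_topology M p) (inv_support_set M p q C G)"
proof -
  interpret Metric_space "Lp M p :: ('s \<Rightarrow> 'x) set set" "Lp_dist M p"
    by (rule Metric_space_Lp)
  show ?thesis
    unfolding Lp_topology_def closedin_metric
  proof (intro conjI allI impI)
    show "inv_support_set M p q C G \<subseteq> Lp M p"
      by (auto simp: inv_support_set_def)
    fix H assume H: "H \<in> Lp M p - inv_support_set M p q C G"
    note h = Lp_rep_in_Lp_fun[of H M p]
    obtain F t where F: "F \<in> C" and t: "0 \<le> t" and less:
      "Lp_seminorm M p (\<lambda>s. Lp_rep H s - t *\<^sub>R (Lp_rep F s - Lp_rep G s)) < Lp_seminorm M p (Lp_rep H)"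
      using H by (auto simp: inv_support_set_iff[OF C G] not_le)
    define k where "k s = t *\<^sub>R (Lp_rep F s - Lp_rep G s)" for s
    have k: "k \<in> Lp_fun M p"
      unfolding k_def using C F G by (intro Lp_fun_scale Lp_fun_diff Lp_rep_in_Lp_fun) auto
    define r where "r = (Lp_seminorm M p (Lp_rep H) - Lp_seminorm M p (\<lambda>s. Lp_rep H s - k s)) / 2"
    show "\<exists>r>0. disjnt (inv_support_set M p q C G) (mball H r)"
    proof (intro exI[of _ r] conjI)
      show "0 < r" using less by (simp add: r_def k_def)
      have False if K: "K \<in> inv_support_set M p q C G" "K \<in> mball H r" for K
      proof -
        have K': "K \<in> Lp M p" using K(1) by (simp add: inv_support_set_def)
        note hk = Lp_rep_in_Lp_fun[OF K'] h
        have d: "Lp_seminorm M p (\<lambda>s. Lp_rep H s - Lp_rep K s) < r"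
          "Lp_seminorm M p (\<lambda>s. Lp_rep K s - Lp_rep H s) < r"
          using K(2) H commute[of H K] by (auto simp: Lp_dist_eq K')
        have "Lp_seminorm M p (Lp_rep H) \<le>
            Lp_seminorm M p (\<lambda>s. Lp_rep H s - Lp_rep K s) + Lp_seminorm M p (Lp_rep K)"
          using Lp_seminorm_triangle[OF Lp_fun_diff[OF hk(2,1)] hk(1)] H by simp
        also have "Lp_seminorm M p (Lp_rep K) \<le> Lp_seminorm M p (\<lambda>s. Lp_rep K s - k s)"
          using K(1) F t by (auto simp: inv_support_set_iff[OF C G] k_def)
        also have "\<dots> \<le> Lp_seminorm M p (\<lambda>s. Lp_rep K s - Lp_rep H s)
            + Lp_seminorm M p (\<lambda>s. Lp_rep H s - k s)"
          using Lp_seminorm_triangle[OF Lp_fun_diff[OF hk] Lp_fun_diff[OF hk(2) k]] H by simp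
        finally show False
          using d by (simp add: r_def)
      qed
      then show "disjnt (inv_support_set M p q C G) (mball H r)"
        by (auto simp: disjnt_iff)
    qed
  qed
qed

text \<open>For \<open>c > 0\<close> the inequality of \<open>c H\<close> with step \<open>t\<close> is \<open>c\<close> times that of \<open>H\<close> with step \<open>t / c\<close>.\<close>

lemma Lp_cone_inv_support_set:
  assumes C: "C \<subseteq> (Lp M p :: ('s \<Rightarrow> 'x) set set)" and G: "G \<in> C"
  shows "Lp_cone M p (Lp_zero M p) (inv_support_set M p q C G)"
  unfolding Lp_cone_def
proof (intro conjI ballI allI impI)
  show "inv_support_set M p q C G \<noteq> {}"
    using zero_in_inv_support_set[OF C G] by blast
  show "inv_support_set M p q C G \<subseteq> Lp M p"
    by (auto simp: inv_support_set_def)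
  fix H and c :: real assume H: "H \<in> inv_support_set M p q C G" and c: "0 \<le> c"
  have H': "H \<in> Lp M p" using H by (simp add: inv_support_set_def)
  note h = Lp_rep_in_Lp_fun[OF H']
  have ch: "(\<lambda>s. c *\<^sub>R Lp_rep H s) \<in> Lp_fun M p" by (rule Lp_fun_scale[OF h])
  define K where "K = Lp_class M p (\<lambda>s. c *\<^sub>R Lp_rep H s)"
  have "Lp_plus M p (Lp_zero M p) (Lp_scale M p c (Lp_minus M p (Lp_class M p (Lp_rep H)) (Lp_zero M p))) = K"
    unfolding Lp_zero_def K_def
    using h by (simp add: Lp_minus_class Lp_scale_class Lp_plus_class Lp_fun_scale Lp_fun_0)
  then have eq: "Lp_plus M p (Lp_zero M p) (Lp_scale M p c (Lp_minus M p H (Lp_zero M p))) = K"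
    by (simp add: Lp_class_rep H')
  have "K \<in> Lp M p" unfolding K_def by (rule Lp_class_in_Lp[OF ch])
  moreover have "Lp_seminorm M p (Lp_rep K) \<le> Lp_seminorm M p (\<lambda>s. Lp_rep K s - t *\<^sub>R (Lp_rep F s - Lp_rep G s))"
    if F: "F \<in> C" and t: "0 \<le> t" for F t
  proof -
    have fg: "(\<lambda>s. Lp_rep F s - Lp_rep G s) \<in> Lp_fun M p"
      using C F G by (intro Lp_fun_diff Lp_rep_in_Lp_fun) auto
    have 1: "Lp_seminorm M p (Lp_rep K) = c * Lp_seminorm M p (Lp_rep H)"
      using c Lp_norm_class[OF ch] by (simp add: Lp_norm_eq K_def Lp_seminorm_scale)
    have 2: "Lp_seminorm M p (\<lambda>s. Lp_rep K s - t *\<^sub>R (Lp_rep F s - Lp_rep G s))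
        = Lp_seminorm M p (\<lambda>s. c *\<^sub>R Lp_rep H s - t *\<^sub>R (Lp_rep F s - Lp_rep G s))"
      unfolding K_def
      by (rule Lp_seminorm_cong_AE, intro Lp_fun_diff Lp_rep_class(1) ch Lp_fun_scale[OF fg],
          intro Lp_fun_diff ch Lp_fun_scale[OF fg]) (use Lp_rep_class(2)[OF ch] in eventually_elim, simp)
    show ?thesis
    proof (cases "c = 0")
      case True
      then show ?thesis by (simp add: 1 Lp_seminorm_nonneg)
    next
      case False
      then have c: "0 < c" using c by simp
      have "Lp_seminorm M p (Lp_rep H) \<le>
          Lp_seminorm M p (\<lambda>s. Lp_rep H s - (t / c) *\<^sub>R (Lp_rep F s - Lp_rep G s))"
        using H F t c by (simp add: inv_support_set_iff[OF C G])
      then have "c * Lp_seminorm M p (Lp_rep H) \<le>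
          Lp_seminorm M p (\<lambda>s. c *\<^sub>R (Lp_rep H s - (t / c) *\<^sub>R (Lp_rep F s - Lp_rep G s)))"
        using c by (simp add: Lp_seminorm_scale)
      also have "(\<lambda>s. c *\<^sub>R (Lp_rep H s - (t / c) *\<^sub>R (Lp_rep F s - Lp_rep G s)))
          = (\<lambda>s. c *\<^sub>R Lp_rep H s - t *\<^sub>R (Lp_rep F s - Lp_rep G s))"
        using c by (simp add: scaleR_diff_right)
      finally show ?thesis by (simp add: 1 2)
    qed
  qed
  ultimately show "Lp_plus M p (Lp_zero M p) (Lp_scale M p c (Lp_minus M p H (Lp_zero M p)))
      \<in> inv_support_set M p q C G"
    unfolding eq by (simp add: inv_support_set_iff[OF C G])
qed

end

section \<open>A non-convex inverse support set\<close>

lemma uniformly_convex_real: "uniformly_convex TYPE(real)"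
  unfolding uniformly_convex_def
proof (intro allI impI)
  fix e :: real assume "0 < e"
  have "norm ((x + y) /\<^sub>R 2) \<le> 1 - 1" if "norm x = 1" "norm y = 1" "e \<le> norm (x - y)" for x y :: real
    using that \<open>0 < e\<close> by (auto simp: abs_if split: if_splits)
  then show "\<exists>d>0. \<forall>x y::real. norm x = 1 \<longrightarrow> norm y = 1 \<longrightarrow> e \<le> norm (x - y) \<longrightarrow> norm ((x + y) /\<^sub>R 2) \<le> 1 - d"
    by (intro exI[of _ 1]) auto
qed

lemma uniformly_smooth_real: "uniformly_smooth TYPE(real)"
  unfolding uniformly_smooth_def
proof (intro allI impI)
  fix e :: real assume e: "0 < e"
  have "(norm (x + t *\<^sub>R y) + norm (x - t *\<^sub>R y)) / 2 - 1 \<le> e * t"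
    if "0 < t" "t < 1" "norm x = 1" "norm y = 1" for t x y :: real
  proof -
    have "(norm (x + t *\<^sub>R y) + norm (x - t *\<^sub>R y)) / 2 - 1 = 0"
      using that by (auto simp: abs_if split: if_splits)
    then show ?thesis using that e by simp
  qed
  then show "\<exists>d>0. \<forall>t. 0 < t \<longrightarrow> t < d \<longrightarrow> (\<forall>x y::real. norm x = 1 \<longrightarrow> norm y = 1 \<longrightarrow>
      (norm (x + t *\<^sub>R y) + norm (x - t *\<^sub>R y)) / 2 - 1 \<le> e * t)"
    by (intro exI[of _ 1]) auto
qed

text \<open>Three dimensions are the fewest possible for real functions: in the plane the duality mapping is an
odd homeomorphism that permutes the rays from the origin, and so convex cones correspond to convex
cones.\<close>

definition three_points :: "nat measure" where
  "three_points = count_space {0, 1, 2}"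

lemma Lp_fun_three_points: "(f :: nat \<Rightarrow> real) \<in> Lp_fun three_points p"
proof -
  have "emeasure three_points {s \<in> space three_points. f s \<noteq> 0} < \<infinity>"
    unfolding three_points_def by (subst emeasure_count_space) (auto simp: less_top[symmetric])
  then have "strongly_measurable three_points f"
    unfolding strongly_measurable_def
    by (intro exI[of _ "\<lambda>i::nat. f"]) (auto simp: three_points_def simple_function_count_space)
  then show ?thesis
    by (simp add: Lp_fun_def three_points_def integrable_count_space)
qed

lemma Lp_seminorm_three_points:
  "Lp_seminorm three_points 4 (f :: nat \<Rightarrow> real) = (f 0 ^ 4 + f 1 ^ 4 + f 2 ^ 4) powr (1 / 4)"
proof -
  have "norm (f s) powr 4 = f s ^ 4" for s
    by (simp add: powr_numeral)
  then show ?thesis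
    by (simp add: Lp_seminorm_def three_points_def lebesgue_integral_count_space_finite add.assoc)
qed

lemma abs_le_Lp_seminorm_three_points:
  assumes "s \<in> {0, 1, 2}"
  shows "\<bar>f s\<bar> \<le> Lp_seminorm three_points 4 (f :: nat \<Rightarrow> real)"
proof -
  have "\<bar>f s\<bar> = (\<bar>f s\<bar> powr 4) powr (1 / 4)"
    by (subst powr_powr) simp
  also have "\<bar>f s\<bar> powr 4 = f s ^ 4"
    by (simp add: powr_numeral)
  also have "(f s ^ 4) powr (1 / 4) \<le> (f 0 ^ 4 + f 1 ^ 4 + f 2 ^ 4) powr (1 / 4)"
    using assms by (intro powr_mono2) auto
  finally show ?thesis by (simp add: Lp_seminorm_three_points)
qed

lemma AE_three_points: "(AE s in three_points. P s) \<longleftrightarrow> P 0 \<and> P 1 \<and> P 2"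
  unfolding three_points_def by (subst AE_count_space) simp

lemma Lp_rep_class_three_points:
  "s \<in> {0, 1, 2} \<Longrightarrow> Lp_rep (Lp_class three_points p (f :: nat \<Rightarrow> real)) s = f s"
  using Lp_rep_class(2)[OF Lp_fun_three_points[of f p]]
  by (auto simp: AE_three_points)

text \<open>The line spanned by \<open>(1, 1, -1)\<close>. At its point 0, the inverse support set consists of the \<open>h\<close> whose
dual annihilates the line, that is, for exponent 4, of the \<open>h\<close> with
\<open>h\<^sub>0\<^sup>3 + h\<^sub>1\<^sup>3 = h\<^sub>2\<^sup>3\<close>. Two solutions are \<open>(1, 0, 1)\<close> and \<open>(0, 1, 1)\<close>, but their midpoint is not one.\<close>

definition diagonal_line :: "(nat \<Rightarrow> real) set set" where
  "diagonal_line = {F \<in> Lp three_points 4. Lp_rep F 1 = Lp_rep F 0 \<and> Lp_rep F 2 = - Lp_rep F 0}"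

lemma nonconvex_inv_support_set:
  "bochner_setting three_points TYPE(real) 4 (4/3)" (is ?setting)
  "closedin (Lp_topology three_points 4) diagonal_line" (is ?closed)
  "Lp_convex three_points 4 diagonal_line" (is ?convex)
  "Lp_zero three_points 4 \<in> diagonal_line" (is ?zero)
  "\<not> Lp_convex three_points 4
      (inv_support_set three_points 4 (4/3) diagonal_line (Lp_zero three_points 4))" (is ?nonconvex)
proof -
  interpret smooth_conjugate_exponents three_points 4 "4/3" "TYPE(real)"
    
    by unfold_locales (auto simp: three_points_def null_sets_count_space uniformly_smooth_real)
  show ?setting
    unfolding bochner_setting_def
    using uniformly_convex_real uniformly_smooth_real complete_measure_axioms by simp
  note rep = Lp_rep_class_three_points[of _ 4]
  note fn = Lp_fun_three_points[of _ 4]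
  have sub: "diagonal_line \<subseteq> Lp three_points 4"
    by (auto simp: diagonal_line_def)
  have cls: "Lp_class three_points 4 f \<in> Lp three_points 4" for f :: "nat \<Rightarrow> real"
    by (rule Lp_class_in_Lp[OF fn])
  show zero: ?zero
    using Lp_zero_in_Lp rep[of _ "\<lambda>s. 0"] by (simp add: diagonal_line_def Lp_zero_def)
  have comb: "Lp_plus three_points 4 (Lp_scale three_points 4 u F) (Lp_scale three_points 4 v G)
      = Lp_class three_points 4 (\<lambda>s. u * Lp_rep F s + v * Lp_rep G s)"
    if "F \<in> Lp three_points 4" "G \<in> Lp three_points 4" for F G :: "(nat \<Rightarrow> real) set" and u v
    using that Lp_scale_class[OF fn, of u "Lp_rep F"] Lp_scale_class[OF fn, of v "Lp_rep G"]
    by (simp add: Lp_class_rep Lp_plus_class fn)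
  show ?convex
    unfolding Lp_convex_def
  proof (intro conjI ballI allI impI sub)
    fix F G and u v :: real
    assume "F \<in> diagonal_line" "G \<in> diagonal_line"
    then show "Lp_plus three_points 4 (Lp_scale three_points 4 u F) (Lp_scale three_points 4 v G)
        \<in> diagonal_line"
      by (subst comb) (auto simp: diagonal_line_def cls rep algebra_simps)
  qed
  show ?closed
  proof -
    interpret Metric_space "Lp three_points 4 :: (nat \<Rightarrow> real) set set" "Lp_dist three_points 4"
      by (rule Metric_space_Lp)
    show ?thesis
      unfolding Lp_topology_def closedin_metric
    proof (intro conjI allI impI sub)
      fix H assume H: "H \<in> Lp three_points 4 - diagonal_line"
      define h where "h = Lp_rep H"
      define r where "r = (\<bar>h 1 - h 0\<bar> + \<bar>h 2 + h 0\<bar>) / 4"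
      have "False" if F: "F \<in> diagonal_line" "F \<in> mball H r" for F
      proof -
        have "Lp_seminorm three_points 4 (\<lambda>s. h s - Lp_rep F s) < r"
          using F(2) by (auto simp: Lp_dist_eq h_def)
        then have "\<bar>h s - Lp_rep F s\<bar> < r" if "s \<in> {0, 1, 2}" for s
          using abs_le_Lp_seminorm_three_points[OF that, of "\<lambda>s. h s - Lp_rep F s"] by simp
        from this[of 0] this[of 1] this[of 2]
        have "\<bar>h 0 - Lp_rep F 0\<bar> < r" "\<bar>h 1 - Lp_rep F 0\<bar> < r" "\<bar>h 2 + Lp_rep F 0\<bar> < r"
          using F(1) by (auto simp: diagonal_line_def)
        then show False
          using abs_triangle_ineq4[of "h 1 - Lp_rep F 0" "h 0 - Lp_rep F 0"]
            abs_triangle_ineq[of "h 2 + Lp_rep F 0" "h 0 - Lp_rep F 0"]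
          by (simp add: r_def)
      qed
      then show "\<exists>r>0. disjnt diagonal_line (mball H r)"
        using H by (intro exI[of _ r]) (auto simp: disjnt_iff r_def h_def diagonal_line_def)
    qed
  qed
  let ?S = "inv_support_set three_points 4 (4/3) diagonal_line (Lp_zero three_points 4)"
  have S_iff: "Lp_class three_points 4 h \<in> ?S \<longleftrightarrow>
      (\<forall>a. h 0 ^ 4 + h 1 ^ 4 + h 2 ^ 4 \<le> (h 0 - a) ^ 4 + (h 1 - a) ^ 4 + (h 2 + a) ^ 4)" for h :: "nat \<Rightarrow> real"
  proof -
    have z: "Lp_rep (Lp_zero three_points 4) s = (0::real)" if "s \<in> {0, 1, 2}" for s
      using rep[OF that, of "\<lambda>s. 0"] by (simp add: Lp_zero_def)
    have pw: "x powr (1/4) \<le> y powr (1/4) \<longleftrightarrow> x \<le> y" if "0 \<le> x" "0 \<le> y" for x y :: real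
      using that powr_mono2[of "1/4" x y] powr_less_mono2[of "1/4" y x] by (auto simp: not_less[symmetric])
    have "Lp_class three_points 4 h \<in> ?S \<longleftrightarrow> (\<forall>F\<in>diagonal_line. \<forall>t\<ge>0.
        h 0 ^ 4 + h 1 ^ 4 + h 2 ^ 4 \<le>
        (h 0 - t * Lp_rep F 0) ^ 4 + (h 1 - t * Lp_rep F 0) ^ 4 + (h 2 + t * Lp_rep F 0) ^ 4)"
      unfolding inv_support_set_iff[OF sub zero]
      by (simp add: cls Lp_seminorm_three_points rep z pw diagonal_line_def)
    also have "\<dots> \<longleftrightarrow> (\<forall>a. h 0 ^ 4 + h 1 ^ 4 + h 2 ^ 4 \<le> (h 0 - a) ^ 4 + (h 1 - a) ^ 4 + (h 2 + a) ^ 4)"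
    proof (intro iffI allI ballI impI)
      fix a :: real
      assume *: "\<forall>F\<in>diagonal_line. \<forall>t\<ge>0. h 0 ^ 4 + h 1 ^ 4 + h 2 ^ 4 \<le>
        (h 0 - t * Lp_rep F 0) ^ 4 + (h 1 - t * Lp_rep F 0) ^ 4 + (h 2 + t * Lp_rep F 0) ^ 4"
      let ?F = "Lp_class three_points 4 (\<lambda>s. if s = 2 then - a else a)"
      have "?F \<in> diagonal_line"
        by (simp add: diagonal_line_def cls rep)
      from *[rule_format, OF this, of 1]
      show "h 0 ^ 4 + h 1 ^ 4 + h 2 ^ 4 \<le> (h 0 - a) ^ 4 + (h 1 - a) ^ 4 + (h 2 + a) ^ 4"
        by (simp add: rep)
    qed auto
    finally show ?thesis .
  qed
  show ?nonconvex
  proof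
    assume conv: "Lp_convex three_points 4 ?S"
    define f g :: "nat \<Rightarrow> real" where "f s = (if s = 1 then 0 else 1)" and "g s = (if s = 0 then 0 else 1)" for s
    have ineq: "2 \<le> (1 - a) ^ 4 + a ^ 4 + (1 + a) ^ 4" for a :: real
    proof -
      have "(1 - a) ^ 4 + a ^ 4 + (1 + a) ^ 4 = 2 + 12 * a ^ 2 + 3 * a ^ 4"
        by (simp add: eval_nat_numeral algebra_simps)
      also have "2 \<le> \<dots>" by simp
      finally show ?thesis .
    qed
    have "Lp_class three_points 4 f \<in> ?S" "Lp_class three_points 4 g \<in> ?S"
      using ineq by (simp_all add: S_iff f_def g_def add.commute)
    then have "Lp_plus three_points 4 (Lp_scale three_points 4 (1/2) (Lp_class three_points 4 f))
        (Lp_scale three_points 4 (1/2) (Lp_class three_points 4 g)) \<in> ?S"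
      using conv unfolding Lp_convex_def by auto
    then have "Lp_class three_points 4 (\<lambda>s. f s / 2 + g s / 2) \<in> ?S"
      by (simp add: Lp_scale_class Lp_plus_class fn)
    \<comment> \<open>Moving the midpoint \<open>(1/2, 1/2, 1)\<close> along the line decreases its norm: the derivative of the
      right-hand side at 0 is \<open>4 (1 - 1/8 - 1/8) > 0\<close>, so a small negative step works.\<close>
    from this[unfolded S_iff, rule_format, of "- (1 / 10)"] show False
      by (simp add: f_def g_def eval_nat_numeral)
  qed
qed

section \<open>The inverse support set: cone, closedness and failure of convexity\<close>

theorem theorem3p13:
  shows "(\<forall>(M :: 's measure) p q (C :: ('s \<Rightarrow> 'x::banach) set set).
            bochner_setting M TYPE('x) p q \<longrightarrow> C \<noteq> {} \<longrightarrow> C \<subseteq> Lp M p \<longrightarrow>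
            closedin (Lp_topology M p) C \<longrightarrow> Lp_convex M p C \<longrightarrow>
            (\<forall>g\<in>C. Lp_zero M p \<in> inv_support_set M p q C g \<and>
                   ({Lp_zero M p} \<subset> inv_support_set M p q C g \<longrightarrow>
                      closedin (Lp_topology M p) (inv_support_set M p q C g) \<and>
                      Lp_cone M p (Lp_zero M p) (inv_support_set M p q C g)))) \<and>
         (\<exists>(M :: nat measure) p q (C :: (nat \<Rightarrow> real) set set).
            bochner_setting M TYPE(real) p q \<and> C \<noteq> {} \<and> C \<subseteq> Lp M p \<and>
            closedin (Lp_topology M p) C \<and> Lp_convex M p C \<and>
            (\<exists>g\<in>C. \<not> Lp_convex M p (inv_support_set M p q C g)))"
proof (rule conjI)
  show "\<forall>(M :: 's measure) p q (C :: ('s \<Rightarrow> 'x::banach) set set).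
            bochner_setting M TYPE('x) p q \<longrightarrow> C \<noteq> {} \<longrightarrow> C \<subseteq> Lp M p \<longrightarrow>
            closedin (Lp_topology M p) C \<longrightarrow> Lp_convex M p C \<longrightarrow>
            (\<forall>g\<in>C. Lp_zero M p \<in> inv_support_set M p q C g \<and>
                   ({Lp_zero M p} \<subset> inv_support_set M p q C g \<longrightarrow>
                      closedin (Lp_topology M p) (inv_support_set M p q C g) \<and>
                      Lp_cone M p (Lp_zero M p) (inv_support_set M p q C g)))"
  proof (intro allI impI ballI)
    fix M :: "'s measure" and p q :: real and C :: "('s \<Rightarrow> 'x) set set" and g
    assume setting: "bochner_setting M TYPE('x) p q" and C: "C \<subseteq> Lp M p" and g: "g \<in> C"
    interpret smooth_conjugate_exponents M p q "TYPE('x)"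
      using setting
      by (simp add: bochner_setting_def smooth_conjugate_exponents_def
          smooth_conjugate_exponents_axioms_def conjugate_exponents_def conjugate_exponents_axioms_def)
    show "Lp_zero M p \<in> inv_support_set M p q C g \<and>
        ({Lp_zero M p} \<subset> inv_support_set M p q C g \<longrightarrow>
          closedin (Lp_topology M p) (inv_support_set M p q C g) \<and>
          Lp_cone M p (Lp_zero M p) (inv_support_set M p q C g))"
      using zero_in_inv_support_set[OF C g] closedin_inv_support_set[OF C g]
        Lp_cone_inv_support_set[OF C g] by blast
  qed
  show "\<exists>(M :: nat measure) p q (C :: (nat \<Rightarrow> real) set set).
            bochner_setting M TYPE(real) p q \<and> C \<noteq> {} \<and> C \<subseteq> Lp M p \<and>
            closedin (Lp_topology M p) C \<and> Lp_convex M p C \<and>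
            (\<exists>g\<in>C. \<not> Lp_convex M p (inv_support_set M p q C g))"
    using nonconvex_inv_support_set by (metis Lp_convex_def empty_iff)
qed

end
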